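(* Let $\mathcal A:\mathbb R^{n_1\times n_2}\to\mathbb R^m$ be linear, $r\ge1$ an integer, and $\alpha>0$, $c>0$ fixed; let $q=\min\{n_1,n_2\}$. The following are equivalent: (i) every matrix $\mathbf X^0$ of rank at most $r$ with $\|\mathbf X^0\|_2=c$ is the unique minimizer of problem (N2) with $\mathbf b=\mathcal A(\mathbf X^0)$; (ii) every $\mathbf H\in\mathrm{Null}(\mathcal A)$ satisfies $$\Big(1+\frac{c}{\alpha}\Big)\sum_{i=1}^r\sigma_i(\mathbf H)\le\sum_{i=r+1}^{q}\sigma_i(\mathbf H).$$
   Context: Problem (N2) is $\min_{\mathbf X}\{\|\mathbf X\|_*+\frac{1}{2\alpha}\|\mathbf X\|_F^2:\ \mathcal A(\mathbf X)=\mathbf b\}$, where $\mathcal A(\mathbf X)_i=\mathrm{trace}(\mathbf A_i^\top\mathbf X)$ for given matrices $\mathbf A_i$. $\sigma_i(\mathbf X)$ is the $i$-th largest singular value; $\|\mathbf X\|_*=\sum_i\sigma_i(\mathbf X)$, $\|\mathbf X\|_F$ the Frobenius norm, $\|\mathbf X\|_2=\sigma_1(\mathbf X)$. *)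

theory Defs
  imports "Jordan_Normal_Form.DL_Rank" "Jordan_Normal_Form.Char_Poly"
    "HOL-Computational_Algebra.Polynomial" "HOL-Library.Multiset"
begin

definition mat_trace :: "real mat \<Rightarrow> real" where
  "mat_trace A = (\<Sum>i<dim_row A. A $$ (i, i))"

definition gram_eigs_desc :: "real mat \<Rightarrow> real list" where
  "gram_eigs_desc X = rev (sorted_list_of_multiset (proots (char_poly (transpose_mat X * X))))"

text \<open>i-th largest singular value (1-indexed): square root of the i-th largest
  eigenvalue of X^T X; 0 beyond the number of eigenvalues.\<close>
definition sing_val :: "nat \<Rightarrow> real mat \<Rightarrow> real" where
  "sing_val i X = (if 1 \<le> i \<and> i \<le> length (gram_eigs_desc X)
                    then sqrt (gram_eigs_desc X ! (i - 1)) else 0)"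

definition nuclear_norm :: "real mat \<Rightarrow> real" where
  "nuclear_norm X = (\<Sum>i = 1..min (dim_row X) (dim_col X). sing_val i X)"

definition spectral_norm :: "real mat \<Rightarrow> real" where
  "spectral_norm X = sing_val 1 X"

definition frob_norm :: "real mat \<Rightarrow> real" where
  "frob_norm X = sqrt (\<Sum>i<dim_row X. \<Sum>j<dim_col X. (X $$ (i, j))\<^sup>2)"

text \<open>The linear measurement operator A(X)_i = trace(A_i^T X), i < m.\<close>
definition meas :: "nat \<Rightarrow> (nat \<Rightarrow> real mat) \<Rightarrow> real mat \<Rightarrow> real vec" where
  "meas m As X = vec m (\<lambda>i. mat_trace (transpose_mat (As i) * X))"

definition null_space_A :: "nat \<Rightarrow> nat \<Rightarrow> nat \<Rightarrow> (nat \<Rightarrow> real mat) \<Rightarrow> real mat set" where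
  "null_space_A n1 n2 m As = {H \<in> carrier_mat n1 n2. meas m As H = 0\<^sub>v m}"

definition obj_N2 :: "real \<Rightarrow> real mat \<Rightarrow> real" where
  "obj_N2 \<alpha> X = nuclear_norm X + (1 / (2 * \<alpha>)) * (frob_norm X)\<^sup>2"

definition unique_min_N2 ::
  "nat \<Rightarrow> nat \<Rightarrow> nat \<Rightarrow> (nat \<Rightarrow> real mat) \<Rightarrow> real \<Rightarrow> real vec \<Rightarrow> real mat \<Rightarrow> bool" where
  "unique_min_N2 n1 n2 m As \<alpha> b X \<longleftrightarrow>
     X \<in> carrier_mat n1 n2 \<and> meas m As X = b \<and>
     (\<forall>Y \<in> carrier_mat n1 n2. meas m As Y = b \<longrightarrow> Y \<noteq> X \<longrightarrow> obj_N2 \<alpha> X < obj_N2 \<alpha> Y)"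

end

theory Submission
  imports Defs
begin

text \<open>
  A matrix \<open>X\<close> is handled through an orthonormal basis of right singular vectors, i.e. an
  orthogonal \<open>V\<close> for which \<open>(X V)\<^sup>T (X V)\<close> is diagonal with the squared singular values.

  Sufficiency of the null space condition rests on the inequality
  \<open>\<parallel>X + H\<parallel>\<^sub>* \<ge> \<parallel>X\<parallel>\<^sub>* + \<parallel>H\<parallel>\<^sub>* - 2 (\<sigma>\<^sub>1(H) + \<dots> + \<sigma>\<^sub>r(H))\<close> for \<open>X\<close> of rank at most \<open>r\<close>.
  Write \<open>X = U S V\<^sup>T\<close> and let \<open>W\<close> be a contraction attaining \<open>\<langle>W, H\<rangle> = \<parallel>H\<parallel>\<^sub>*\<close>, scaled by
  a factor below 1. Then
  \<open>L = W + (U - W V) (I - U\<^sup>T W V)\<^sup>-\<^sup>1 (V\<^sup>T - U\<^sup>T W)\<close> is a contraction with \<open>L V = U\<close>, so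
  \<open>\<langle>L, X\<rangle> = \<parallel>X\<parallel>\<^sub>*\<close>, and \<open>(W - L) / 2\<close> is a contraction of rank at most \<open>r\<close>, so
  \<open>\<langle>W - L, H\<rangle>\<close> is at most twice the Ky Fan norm of \<open>H\<close>. Pairing \<open>L\<close> with \<open>X + H\<close> gives the claim.
  The quadratic term contributes \<open>\<langle>X, H\<rangle> \<ge> - c (\<sigma>\<^sub>1(H) + \<dots> + \<sigma>\<^sub>r(H))\<close> and the strictly
  positive \<open>\<parallel>H\<parallel>\<^sub>F\<^sup>2\<close>.

  For necessity take \<open>X\<close> to be \<open>- c\<close> times the polar factor of the best rank \<open>r\<close>
  approximation of \<open>H\<close>: the objective along \<open>X + t H\<close> is explicit in the singular values of \<open>H\<close>,
  and its one-sided derivative at \<open>t = 0\<close> is the difference of the two sides of the condition.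
\<close>

declare col_mult [simp del]
  \<comment> \<open>competes with \<open>col_mult2\<close>, whose right-hand side is a matrix-vector product\<close>

subsection \<open>Orthogonal diagonalization of real symmetric matrices\<close>

lemma symmetric_char_poly_splits:
  fixes A :: "real mat"
  assumes A: "A \<in> carrier_mat n n" and sym: "transpose_mat A = A"
  shows "\<exists>es. char_poly A = (\<Prod>e\<leftarrow>es. [:- e, 1:])"
\<comment> \<open>Over the complex numbers the characteristic polynomial splits. Pairing an
  eigenvector with its conjugate and moving the real symmetric matrix across gives a =
  \<open>cnj a\<close>, so every root is real.\<close>
proof -
  let ?C = "map_mat complex_of_real A"
  have C: "?C \<in> carrier_mat n n" using A by simp
  have hom: "char_poly ?C = map_poly complex_of_real (char_poly A)"
    by (rule of_real_hom.char_poly_hom[OF A])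
  obtain as where as: "char_poly ?C = (\<Prod>a\<leftarrow>as. [:- a, 1:])"
    using char_poly_factorized[OF C] by blast
  have real: "a = complex_of_real (Re a)" if a: "a \<in> set as" for a
  proof -
    have "poly (char_poly ?C) a = 0"
      unfolding as using a by (induction as) auto
    then have "eigenvalue ?C a" using eigenvalue_root_char_poly[OF C] by simp
    then obtain z where z: "z \<in> carrier_vec n" "z \<noteq> 0\<^sub>v n" "?C *\<^sub>v z = a \<cdot>\<^sub>v z"
      unfolding eigenvalue_def eigenvector_def using C by auto
    have symC: "transpose_mat ?C = ?C" using sym by (metis map_mat_transpose)
    have conjC: "?C *\<^sub>v conjugate z = conjugate (?C *\<^sub>v z)"
    proof (rule eq_vecI)
      fix i assume "i < dim_vec (conjugate (?C *\<^sub>v z))"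
      then have i: "i < n" using A by simp
      show "(?C *\<^sub>v conjugate z) $ i = conjugate (?C *\<^sub>v z) $ i"
        using i A z(1) by (auto simp: scalar_prod_def conjugate_complex_def)
    qed (use A in simp)
    have "a * (z \<bullet>c z) = (?C *\<^sub>v z) \<bullet>c z"
      using z by simp
    also have "\<dots> = z \<bullet> (?C *\<^sub>v conjugate z)"
      using transpose_vec_mult_scalar[OF C z(1), of "conjugate z"] z(1) C symC
      by (metis (no_types, lifting) assoc_scalar_prod carrier_vec_conjugate comm_scalar_prod
            mult_mat_vec_carrier transpose_vec_mult_scalar)
    also have "\<dots> = cnj a * (z \<bullet>c z)"
      unfolding conjC z(3) using z(1) by (simp add: conjugate_smult_vec conjugate_complex_def)
    finally have "a = cnj a"
      using z conjugate_square_eq_0_vec[OF z(1)] by simp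
    then show ?thesis by (metis Reals_cnj_iff of_real_Re)
  qed
  have "map_poly complex_of_real (char_poly A) = (\<Prod>a\<leftarrow>map (complex_of_real \<circ> Re) as. [:- a, 1:])"
    using real map_idI[of as "complex_of_real \<circ> Re"] by (simp add: hom[symmetric] as)
  also have "\<dots> = map_poly complex_of_real (\<Prod>e\<leftarrow>map Re as. [:- e, 1:])"
  proof -
    interpret h: map_poly_comm_ring_hom complex_of_real ..
    have "map_poly complex_of_real [:- e, 1:] = [:- complex_of_real e, 1:]" for e
      by (simp add: map_poly_pCons)
    then show ?thesis by (induction as) (simp_all add: h.hom_mult del: mult_pCons_left)
  qed
  finally have "char_poly A = (\<Prod>e\<leftarrow>map Re as. [:- e, 1:])"
    by (metis (no_types, lifting) coeff_map_poly of_real_0 of_real_eq_iff poly_eqI)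
  then show ?thesis by blast
qed

text \<open>Reflection in the hyperplane orthogonal to w = v - e_0: it exchanges the unit vectors
  e_0 and v. When v = e_0 the vector w vanishes and the identity serves instead.\<close>

lemma householder:
  fixes v :: "real vec"
  assumes v: "v \<in> carrier_vec n" and n: "0 < n" and unit: "v \<bullet> v = 1"
  shows "\<exists>Q \<in> carrier_mat n n. transpose_mat Q = Q \<and> Q * Q = 1\<^sub>m n \<and> Q *\<^sub>v unit_vec n 0 = v"
proof (cases "v = unit_vec n 0")
  case True
  then show ?thesis by (intro bexI[of _ "1\<^sub>m n"]) auto
next
  case False
  define w where "w = v - unit_vec n 0"
  have w: "w \<in> carrier_vec n" using v by (simp add: w_def)
  have "w \<noteq> 0\<^sub>v n"
  proof
    assume "w = 0\<^sub>v n"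
    then have "v $ i = unit_vec n 0 $ i" if "i < n" for i
      using that v by (auto simp: w_def dest!: arg_cong[where f = "\<lambda>u. u $ i"])
    then show False using False v by auto
  qed
  then have ww0: "w \<bullet> w \<noteq> 0"
    using conjugate_square_eq_0_vec[OF w] by simp
  have we: "w \<bullet> unit_vec n 0 = v $ 0 - 1"
    unfolding w_def using v n by (simp add: minus_scalar_prod_distrib[of _ n])
  have ww: "w \<bullet> w = 2 - 2 * v $ 0"
    unfolding w_def using v n unit
    by (simp add: minus_scalar_prod_distrib[of _ n] scalar_prod_minus_distrib[of _ n])
  define c where "c = 2 / (w \<bullet> w)"
  define Q where "Q = mat n n (\<lambda>(i, j). (if i = j then 1 else 0) - c * w $ i * w $ j)"
  have Q: "Q \<in> carrier_mat n n" by (simp add: Q_def)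
  have "transpose_mat Q = Q" by (rule eq_matI) (auto simp: Q_def)
  moreover have "Q * Q = 1\<^sub>m n"
  proof (rule eq_matI)
    fix i j assume "i < dim_row (1\<^sub>m n :: real mat)" "j < dim_col (1\<^sub>m n :: real mat)"
    then have ij: "i < n" "j < n" by auto
    have "(Q * Q) $$ (i, j) = (\<Sum>k<n. Q $$ (i, k) * Q $$ (k, j))"
      using ij Q by (simp add: scalar_prod_def lessThan_atLeast0)
    also have "\<dots> = (\<Sum>k<n. (if k = i then (if i = j then 1 else 0) - c * w $ i * w $ j else 0)
        - (if k = j then c * w $ i * w $ j else 0) + c * c * w $ i * w $ j * (w $ k * w $ k))"
      by (rule sum.cong) (use ij in \<open>auto simp: Q_def algebra_simps\<close>)
    also have "\<dots> = (if i = j then 1 else 0) - 2 * c * w $ i * w $ j + c * c * w $ i * w $ j * (w \<bullet> w)"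
      using ij w by (simp add: sum.distrib sum_subtractf sum_distrib_left[symmetric]
          scalar_prod_def lessThan_atLeast0)
    also have "\<dots> = (if i = j then 1 else 0)"
      using ww0 by (simp add: c_def)
    finally show "(Q * Q) $$ (i, j) = 1\<^sub>m n $$ (i, j)" using ij by simp
  qed (use Q in auto)
  moreover have "Q *\<^sub>v unit_vec n 0 = v"
  proof (rule eq_vecI)
    fix i assume "i < dim_vec v"
    then have i: "i < n" using v by simp
    have "(Q *\<^sub>v unit_vec n 0) $ i = Q $$ (i, 0)" using i n Q by simp
    also have "\<dots> = (if i = 0 then 1 else 0) - c * w $ i * w $ 0" using i n by (simp add: Q_def)
    \<comment> \<open>As v has length 1, w . w = 2 - 2 v_0 = -2 w_0, and c is 2 / (w . w).\<close>
    also have "c * w $ 0 = -1"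
      using ww0 we ww n v by (simp add: c_def w_def field_simps)
    then have "c * w $ i * w $ 0 = - (w $ i)" by (metis mult.assoc mult.commute mult_minus1)
    finally show "(Q *\<^sub>v unit_vec n 0) $ i = v $ i" using i n v by (auto simp: w_def)
  qed (use Q v in auto)
  ultimately show ?thesis using Q by blast
qed


text \<open>Deflation along the list of eigenvalues: a reflection carries e_0 to a unit eigenvector
  for the head e, so by symmetry the conjugated matrix is block diagonal with blocks e and
  \<open>A3\<close>, and \<open>A3\<close> loses exactly the factor of e. The diagonal keeps the
  order of \<open>es\<close>, so a sorted list gives a sorted diagonal.\<close>

lemma symmetric_orthogonal_diagonalization:
  fixes A :: "real mat"
  assumes "A \<in> carrier_mat n n" and "transpose_mat A = A"
    and "char_poly A = (\<Prod>e\<leftarrow>es. [:- e, 1:])"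
  shows "\<exists>V \<in> carrier_mat n n. transpose_mat V * V = 1\<^sub>m n
    \<and> transpose_mat V * A * V = mat_diag n (\<lambda>i. es ! i)"
  using assms
proof (induction es arbitrary: n A)
  case Nil
  then have "n = 0" using degree_monic_char_poly[of A n] by simp
  with Nil show ?case
    by (intro bexI[of _ "1\<^sub>m 0"] conjI eq_matI) (auto simp: mat_diag_def)
next
  case (Cons e es)
  note A = Cons.prems(1) and sym = Cons.prems(2)
  have ev: "eigenvalue A e"
    unfolding eigenvalue_root_char_poly[OF A] Cons.prems(3) by simp
  then obtain m where n: "n = Suc m"
    using eigenvalue_imp_nonzero_dim[OF A] by (cases n) auto
  from ev obtain u where u: "u \<in> carrier_vec n" "u \<noteq> 0\<^sub>v n" "A *\<^sub>v u = e \<cdot>\<^sub>v u"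
    unfolding eigenvalue_def eigenvector_def using A by auto
  have uu: "u \<bullet> u > 0"
    using conjugate_square_greater_0_vec[OF u(1)] u(2) by simp
  define v where "v = (1 / sqrt (u \<bullet> u)) \<cdot>\<^sub>v u"
  have v: "v \<in> carrier_vec n" using u by (simp add: v_def)
  have vv: "v \<bullet> v = 1" using u uu by (simp add: v_def)
  have Av: "A *\<^sub>v v = e \<cdot>\<^sub>v v"
    unfolding v_def using u A by (simp add: mult_mat_vec[of _ n n] smult_smult_assoc mult.commute)
  obtain Q where Q: "Q \<in> carrier_mat n n" and Qs: "transpose_mat Q = Q" and QQ: "Q * Q = 1\<^sub>m n"
    and Qv: "Q *\<^sub>v unit_vec n 0 = v"
    using householder[OF v _ vv] n by auto
  have Qv': "Q *\<^sub>v v = unit_vec n 0"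
    unfolding Qv[symmetric] using Q QQ by (simp flip: assoc_mult_mat_vec[of _ n n _ n])
  define B where "B = Q * A * Q"
  have B: "B \<in> carrier_mat n n" using Q A by (simp add: B_def)
  have Bs: "transpose_mat B = B"
    unfolding B_def using Q A Qs sym
    by (simp add: transpose_mult[of _ n n _ n] assoc_mult_mat[of _ n n _ n _ n])
  have "B *\<^sub>v unit_vec n 0 = e \<cdot>\<^sub>v unit_vec n 0"
    unfolding B_def using Q A v
    by (simp add: assoc_mult_mat_vec[of _ n n _ n] Qv Av Qv' mult_mat_vec[of _ n n])
  then have "(B *\<^sub>v unit_vec n 0) $ i = (e \<cdot>\<^sub>v unit_vec n 0) $ i" for i by simp
  then have B0: "B $$ (i, 0) = (if i = 0 then e else 0)" if "i < n" for i
    using that B n by (auto dest!: meta_spec[of _ i])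
  have B0': "B $$ (0, i) = (if i = 0 then e else 0)" if "i < n" for i
    using B0[OF that] Bs B that n by (metis carrier_matD index_transpose_mat(1) zero_less_Suc)
  define A3 where "A3 = mat m m (\<lambda>(i, j). B $$ (Suc i, Suc j))"
  let ?e = "mat 1 1 (\<lambda>_. e)"
  have A3: "A3 \<in> carrier_mat m m" by (simp add: A3_def)
  have Bblock: "B = four_block_mat ?e (0\<^sub>m 1 m) (0\<^sub>m m 1) A3"
    by (rule eq_matI) (use B n in \<open>auto simp: A3_def B0 B0'\<close>)
  have A3s: "transpose_mat A3 = A3"
  proof (rule eq_matI)
    fix i j assume "i < dim_row A3" "j < dim_col A3"
    then have "i < m" "j < m" using A3 by auto
    then show "transpose_mat A3 $$ (i, j) = A3 $$ (i, j)"
      using arg_cong[OF Bs, of "\<lambda>M. M $$ (Suc i, Suc j)"] B n by (simp add: A3_def)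
  qed (use A3 in auto)
  have "similar_mat_wit B A Q Q"
    by (rule similar_mat_witI[of _ _ n]) (use Q A QQ B in \<open>auto simp: B_def\<close>)
  then have "char_poly B = char_poly A"
    by (intro char_poly_similar) (auto simp: similar_mat_def)
  moreover have "char_poly B = char_poly ?e * char_poly A3"
    unfolding Bblock by (rule char_poly_four_block_zeros_col) (use A3 in auto)
  moreover have "char_poly ?e = [:- e, 1:]"
    by (simp add: char_poly_defs det_def sign_def)
  ultimately have cp: "char_poly A3 = (\<Prod>e\<leftarrow>es. [:- e, 1:])"
    using Cons.prems(3)
    by (metis (no_types, lifting) list.map(2) mult_cancel_left pCons_eq_0_iff prod_list.Cons
        zero_neq_one)
  obtain V where V: "V \<in> carrier_mat m m" and VV: "transpose_mat V * V = 1\<^sub>m m"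
    and VAV: "transpose_mat V * A3 * V = mat_diag m (\<lambda>i. es ! i)"
    using Cons.IH[OF A3 A3s cp] by blast
  define F where "F = four_block_mat (1\<^sub>m 1) (0\<^sub>m 1 m) (0\<^sub>m m 1) V"
  have F: "F \<in> carrier_mat n n" using V n by (auto simp: F_def)
  have Ft: "transpose_mat F = four_block_mat (1\<^sub>m 1) (0\<^sub>m 1 m) (0\<^sub>m m 1) (transpose_mat V)"
    unfolding F_def using V by (subst transpose_four_block_mat[of _ 1 1 _ m _ m]) auto
  have "transpose_mat F * F = four_block_mat (1\<^sub>m 1) (0\<^sub>m 1 m) (0\<^sub>m m 1) (1\<^sub>m m)"
    unfolding Ft unfolding F_def using V VV
    by (subst mult_four_block_mat[of _ 1 1 _ m _ m _ _ 1 _ m]) auto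
  then have FF: "transpose_mat F * F = 1\<^sub>m n" using n by simp
  have "transpose_mat F * B * F
      = four_block_mat ?e (0\<^sub>m 1 m) (0\<^sub>m m 1) (transpose_mat V * A3 * V)"
    unfolding Ft Bblock unfolding F_def using V A3
    by (simp add: mult_four_block_mat[of _ 1 1 _ m _ m _ _ 1 _ m])
  also have "\<dots> = mat_diag n (\<lambda>i. (e # es) ! i)"
    unfolding VAV by (rule eq_matI) (auto simp: mat_diag_def n nth_Cons')
  finally have FBF: "transpose_mat F * B * F = mat_diag n (\<lambda>i. (e # es) ! i)" .
  have "transpose_mat (Q * F) * (Q * F) = transpose_mat F * (Q * Q) * F"
    using Q F Qs by (simp add: transpose_mult[of _ n n _ n] assoc_mult_mat[of _ n n _ n _ n])
  then have 1: "transpose_mat (Q * F) * (Q * F) = 1\<^sub>m n"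
    using FF F QQ by simp
  have 2: "transpose_mat (Q * F) * A * (Q * F) = mat_diag n (\<lambda>i. (e # es) ! i)"
    unfolding FBF[symmetric] B_def
    using Q F Qs A by (simp add: transpose_mult[of _ n n _ n] assoc_mult_mat[of _ n n _ n _ n])
  show ?case using 1 2 Q F by (intro bexI[of _ "Q * F"]) auto
qed

subsection \<open>Rank factorizations\<close>

lemma mult_mat_zero_vec:
  fixes A :: "'a :: semiring_0 mat"
  shows "A \<in> carrier_mat n k \<Longrightarrow> A *\<^sub>v 0\<^sub>v k = 0\<^sub>v n"
  by (rule eq_vecI) auto

text \<open>Zero rows pad \<open>G\<close> to a square matrix \<open>P\<close>. Row k of
  \<open>P\<close> is zero, so the transpose kills the unit vector at k, \<open>det P\<close> = 0
  and \<open>P\<close> has a kernel vector.\<close>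

lemma wide_mat_kernel:
  fixes G :: "'a :: field mat"
  assumes G: "G \<in> carrier_mat k l" and kl: "k < l"
  shows "\<exists>a \<in> carrier_vec l. a \<noteq> 0\<^sub>v l \<and> G *\<^sub>v a = 0\<^sub>v k"
proof -
  define P where "P = mat l l (\<lambda>(i, j). if i < k then G $$ (i, j) else 0)"
  have P: "P \<in> carrier_mat l l" by (simp add: P_def)
  have "transpose_mat P *\<^sub>v unit_vec l k = 0\<^sub>v l"
    by (rule eq_vecI) (use kl in \<open>auto simp: P_def\<close>)
  then have "det (transpose_mat P) = 0"
    using det_0_iff_vec_prod_zero_field[of "transpose_mat P" l] P kl
    by (metis transpose_carrier_mat unit_vec_carrier unit_vec_nonzero)
  then have "det P = 0" using det_transpose[OF P] by simp
  then obtain a where a: "a \<in> carrier_vec l" "a \<noteq> 0\<^sub>v l" "P *\<^sub>v a = 0\<^sub>v l"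
    using det_0_iff_vec_prod_zero_field[OF P] by auto
  have "G *\<^sub>v a = 0\<^sub>v k"
  proof (rule eq_vecI)
    fix i assume "i < dim_vec (0\<^sub>v k :: 'a vec)"
    then have i: "i < k" by simp
    have "row P i = row G i" by (rule eq_vecI) (use i kl G in \<open>auto simp: P_def\<close>)
    moreover have "(P *\<^sub>v a) $ i = 0" using a(3) i kl by simp
    ultimately show "(G *\<^sub>v a) $ i = 0\<^sub>v k $ i" using i kl G P by simp
  qed (use G in simp)
  with a show ?thesis by blast
qed

text \<open>A maximal independent set of columns of C G is C times a selection \<open>G'\<close> of
  columns of G. With more than k columns, \<open>G'\<close> would have a nonzero kernel vector,
  which is a linear dependence of the selected columns.\<close>

lemma rank_mult_le:
  fixes C G :: "'a :: field mat"
  assumes C: "C \<in> carrier_mat n k" and G: "G \<in> carrier_mat k m"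
  shows "vec_space.rank n (C * G) \<le> k"
proof -
  interpret vec_space "TYPE('a)" n .
  have CG: "C * G \<in> carrier_mat n m" using C G by simp
  obtain S where S: "maximal S (\<lambda>T. T \<subseteq> set (cols (C * G)) \<and> lin_indpt T)"
    using maximal_exists_superset[of "set (cols (C * G))"
        "\<lambda>T. T \<subseteq> set (cols (C * G)) \<and> lin_indpt T" "{}"]
    by (auto simp: lin_dep_def)
  then have sub: "S \<subseteq> set (cols (C * G))" and li: "lin_indpt S" by (auto simp: maximal_def)
  have "finite S" using sub finite_subset by blast
  then obtain bs where bs: "set bs = S" "distinct bs" using finite_distinct_list by blast
  have bsc: "set bs \<subseteq> carrier_vec n"
    using sub bs cols_dim[of "C * G"] C by auto
  have "\<forall>i<length bs. \<exists>j<m. bs ! i = col (C * G) j"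
  proof (intro allI impI)
    fix i assume "i < length bs"
    then have "bs ! i \<in> set (cols (C * G))" using bs sub nth_mem by blast
    then show "\<exists>j<m. bs ! i = col (C * G) j" using G by (auto simp: cols_def)
  qed
  then obtain f where f: "\<And>i. i < length bs \<Longrightarrow> f i < m \<and> bs ! i = col (C * G) (f i)" by metis
  define G' where "G' = mat k (length bs) (\<lambda>(i, j). G $$ (i, f j))"
  have G': "G' \<in> carrier_mat k (length bs)" by (simp add: G'_def)
  have eq: "mat_of_cols n bs = C * G'"
  proof (rule mat_col_eqI)
    fix i assume "i < dim_col (C * G')"
    then have i: "i < length bs" using G' by simp
    have "col G' i = col G (f i)" by (rule eq_vecI) (use i f[OF i] G in \<open>auto simp: G'_def\<close>)
    then show "col (mat_of_cols n bs) i = col (C * G') i"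
      using i f[OF i] C G G' bsc col_mat_of_cols[OF i, of n] nth_mem[OF i] by auto
  qed (use C G' in auto)
  have "length bs \<le> k"
  proof (rule ccontr)
    assume "\<not> length bs \<le> k"
    then obtain a where a: "a \<in> carrier_vec (length bs)" "a \<noteq> 0\<^sub>v (length bs)" "G' *\<^sub>v a = 0\<^sub>v k"
      using wide_mat_kernel[OF G'] by auto
    have "mat_of_cols n bs *\<^sub>v a = 0\<^sub>v n"
      unfolding eq using C G' a by (simp add: assoc_mult_mat_vec[of _ n k _ "length bs"] mult_mat_zero_vec)
    then have "lin_dep (set (cols (mat_of_cols n bs)))"
      using lin_depI[of "mat_of_cols n bs" "length bs" a] a bsc bs(2) by simp
    then show False using li bs bsc by simp
  qed
  moreover have "rank (C * G) = card S" by (rule rank_card_indpt[OF CG S])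
  ultimately show ?thesis using bs distinct_card by fastforce
qed

text \<open>\<open>C\<close> collects a maximal independent set of columns of X; \<open>G\<close>
  holds the coordinates of all columns of X with respect to it.\<close>

lemma rank_factorization:
  fixes X :: "'a :: field mat"
  assumes X: "X \<in> carrier_mat n m"
  obtains C G where "C \<in> carrier_mat n (vec_space.rank n X)"
    "G \<in> carrier_mat (vec_space.rank n X) m" "X = C * G"
proof -
  interpret vec_space "TYPE('a)" n .
  obtain S where S: "maximal S (\<lambda>T. T \<subseteq> set (cols X) \<and> lin_indpt T)"
    using maximal_exists_superset[of "set (cols X)" "\<lambda>T. T \<subseteq> set (cols X) \<and> lin_indpt T" "{}"]
    by (auto simp: lin_dep_def)
  then have sub: "S \<subseteq> set (cols X)" and li: "lin_indpt S" by (auto simp: maximal_def)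
  have fin: "finite S" using sub finite_subset by blast
  then obtain bs where bs: "set bs = S" "distinct bs" using finite_distinct_list by blast
  have colsc: "set (cols X) \<subseteq> carrier_vec n" using cols_dim X by blast
  then have bsc: "set bs \<subseteq> carrier_vec n" using sub bs by auto
  have rank: "rank X = length bs"
    using rank_card_indpt[OF X S] bs distinct_card by fastforce
  have in_span: "x \<in> span S" if x: "x \<in> set (cols X)" for x
  proof (rule ccontr)
    assume "x \<notin> span S"
    moreover have "x \<notin> S" using calculation bsc bs span_mem by auto
    ultimately have "lin_indpt (S \<union> {x})"
      using lin_dep_iff_in_span[of S x] li bsc bs x colsc by auto
    then show False using S x sub \<open>x \<notin> S\<close> unfolding maximal_def by blast
  qed
  define C where "C = mat_of_cols n bs"
  have C: "C \<in> carrier_mat n (length bs)" by (simp add: C_def)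
  have colsC: "cols C = bs" using bsc by (simp add: C_def)
  have "\<forall>j<m. \<exists>g\<in>carrier_vec (length bs). col X j = C *\<^sub>v g"
  proof (intro allI impI)
    fix j assume "j < m"
    then have "col X j \<in> span S" using in_span X by (auto simp: cols_def)
    then obtain a where "col X j = lincomb a S"
      using finite_in_span[OF fin] bsc bs by metis
    then have "col X j = C *\<^sub>v vec (length bs) (\<lambda>i. a (col C i))"
      using mat_mult_eq_lincomb[OF C] colsC bs by simp
    then show "\<exists>g\<in>carrier_vec (length bs). col X j = C *\<^sub>v g" by (intro bexI) auto
  qed
  then obtain g where g: "\<And>j. j < m \<Longrightarrow> g j \<in> carrier_vec (length bs) \<and> col X j = C *\<^sub>v g j"
    by metis
  define G where "G = mat (length bs) m (\<lambda>(i, j). g j $ i)"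
  have G: "G \<in> carrier_mat (length bs) m" by (simp add: G_def)
  have "X = C * G"
  proof (rule mat_col_eqI)
    fix j assume "j < dim_col (C * G)"
    then have j: "j < m" using G by simp
    have "col G j = g j" by (rule eq_vecI) (use j g[OF j] in \<open>auto simp: G_def\<close>)
    then show "col X j = col (C * G) j" using j g[OF j] C G by simp
  qed (use X C G in auto)
  with C G rank that show ?thesis by metis
qed

subsection \<open>Singular systems\<close>

lemma dim_mat_diag [simp]: "dim_row (mat_diag n g) = n" "dim_col (mat_diag n g) = n"
  by (simp_all add: mat_diag_def)

text \<open>A singular value decomposition without left singular vectors: the columns of X V are
  orthogonal with lengths \<open>s i\<close>. This avoids dividing by zero singular values. The
  \<open>s i\<close> may come in any order, so that matrices obtained by rescaling fit as
  well.\<close>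

definition right_singular_system ::
  "nat \<Rightarrow> nat \<Rightarrow> real mat \<Rightarrow> real mat \<Rightarrow> (nat \<Rightarrow> real) \<Rightarrow> bool" where
  "right_singular_system n1 n2 X V s \<longleftrightarrow>
     X \<in> carrier_mat n1 n2 \<and> V \<in> carrier_mat n2 n2 \<and> transpose_mat V * V = 1\<^sub>m n2 \<and>
     (\<forall>i<n2. 0 \<le> s i) \<and>
     transpose_mat (X * V) * (X * V) = mat_diag n2 (\<lambda>i. (s i)\<^sup>2)"

lemma right_singular_systemD:
  assumes "right_singular_system n1 n2 X V s"
  shows "X \<in> carrier_mat n1 n2" "V \<in> carrier_mat n2 n2" "transpose_mat V * V = 1\<^sub>m n2"
    "V * transpose_mat V = 1\<^sub>m n2" "\<And>i. i < n2 \<Longrightarrow> 0 \<le> s i"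
    "transpose_mat (X * V) * (X * V) = mat_diag n2 (\<lambda>i. (s i)\<^sup>2)"
  using assms mat_mult_left_right_inverse[of "transpose_mat V" n2 V]
  by (auto simp: right_singular_system_def)

lemma scalar_prod_mult_mat_vec:
  fixes A B :: "real mat"
  assumes "A \<in> carrier_mat n m" "B \<in> carrier_mat n l" "x \<in> carrier_vec m" "y \<in> carrier_vec l"
  shows "(A *\<^sub>v x) \<bullet> (B *\<^sub>v y) = x \<bullet> ((transpose_mat A * B) *\<^sub>v y)"
proof -
  have "(A *\<^sub>v x) \<bullet> (B *\<^sub>v y) = (transpose_mat (transpose_mat A) *\<^sub>v x) \<bullet> (B *\<^sub>v y)" by simp
  also have "\<dots> = x \<bullet> (transpose_mat A *\<^sub>v (B *\<^sub>v y))"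
    by (rule transpose_vec_mult_scalar) (use assms in auto)
  finally show ?thesis
    using assms by (simp add: assoc_mult_mat_vec[of _ m n _ l])
qed

lemma mat_diag_mult_vec_index:
  fixes g :: "nat \<Rightarrow> real"
  assumes "b \<in> carrier_vec n" "i < n"
  shows "(mat_diag n g *\<^sub>v b) $ i = g i * b $ i"
proof -
  have "(mat_diag n g *\<^sub>v b) $ i = (\<Sum>j = 0..<n. (if i = j then g j else 0) * b $ j)"
    using assms by (simp add: mat_diag_def scalar_prod_def)
  also have "\<dots> = (\<Sum>j = 0..<n. if i = j then g j * b $ j else 0)"
    by (rule sum.cong) auto
  finally show ?thesis using assms by simp
qed

lemma right_singular_system_gram:
  assumes "right_singular_system n1 n2 X V s" and b: "b \<in> carrier_vec n2"
  shows "(X *\<^sub>v (V *\<^sub>v b)) \<bullet> (X *\<^sub>v (V *\<^sub>v b)) = (\<Sum>i<n2. (s i)\<^sup>2 * (b $ i)\<^sup>2)"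
proof -
  note D = right_singular_systemD[OF assms(1)]
  have "(X *\<^sub>v (V *\<^sub>v b)) \<bullet> (X *\<^sub>v (V *\<^sub>v b)) = ((X * V) *\<^sub>v b) \<bullet> ((X * V) *\<^sub>v b)"
    using D b by (simp add: assoc_mult_mat_vec[of _ n1 n2 _ n2])
  also have "\<dots> = b \<bullet> (mat_diag n2 (\<lambda>i. (s i)\<^sup>2) *\<^sub>v b)"
    using scalar_prod_mult_mat_vec[OF _ _ b b, of "X * V" n1 "X * V"] D(1,2) unfolding D(6) by simp
  also have "\<dots> = (\<Sum>i<n2. b $ i * (mat_diag n2 (\<lambda>i. (s i)\<^sup>2) *\<^sub>v b) $ i)"
    unfolding scalar_prod_def by (simp add: lessThan_atLeast0 del: index_mult_mat_vec)
  also have "\<dots> = (\<Sum>i<n2. (s i)\<^sup>2 * (b $ i)\<^sup>2)"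
    by (rule sum.cong)
      (auto simp: mat_diag_mult_vec_index[OF b] power2_eq_square simp del: index_mult_mat_vec)
  finally show ?thesis .
qed

lemma right_singular_system_cols:
  assumes "right_singular_system n1 n2 X V s" and ij: "i < n2" "j < n2"
  shows "(X *\<^sub>v col V i) \<bullet> (X *\<^sub>v col V j) = (if i = j then (s i)\<^sup>2 else 0)"
proof -
  note D = right_singular_systemD[OF assms(1)]
  have "(X *\<^sub>v col V i) \<bullet> (X *\<^sub>v col V j) = (transpose_mat (X * V) * (X * V)) $$ (i, j)"
    using D(1,2) ij by simp
  then show ?thesis unfolding D(6) using ij by (simp add: mat_diag_def)
qed

lemma orthogonal_cols:
  fixes V :: "real mat"
  assumes "V \<in> carrier_mat n m" "transpose_mat V * V = 1\<^sub>m m" "i < m" "j < m"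
  shows "col V i \<bullet> col V j = (if i = j then 1 else 0)"
proof -
  have "col V i \<bullet> col V j = (transpose_mat V * V) $$ (i, j)" using assms(1,3,4) by simp
  then show ?thesis unfolding assms(2) using assms(3,4) by simp
qed

section \<open>Singular values as roots of the characteristic polynomial of the Gram matrix\<close>

lemma proots_linear_factors: "proots (\<Prod>e\<leftarrow>es. [:- e, 1:]) = mset (es :: real list)"
proof (induction es)
  case (Cons e es)
  have "(\<Prod>e\<leftarrow>es. [:- e, 1:]) \<noteq> (0 :: real poly)" by (auto simp: prod_list_zero_iff)
  then have "proots ([:- e, 1:] * (\<Prod>e\<leftarrow>es. [:- e, 1:])) = {#e#} + mset es"
    by (subst proots_mult) (simp_all add: Cons)
  then show ?case by (simp del: mult_pCons_left)
qed simp

lemma mset_gram_eigs_desc: "mset (gram_eigs_desc X) = proots (char_poly (transpose_mat X * X))"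
  by (simp add: gram_eigs_desc_def)

lemma char_poly_gram:
  assumes "X \<in> carrier_mat n1 n2"
  shows "char_poly (transpose_mat X * X) = (\<Prod>e\<leftarrow>gram_eigs_desc X. [:- e, 1:])"
    and "length (gram_eigs_desc X) = n2"
proof -
  let ?A = "transpose_mat X * X"
  have A: "?A \<in> carrier_mat n2 n2" using assms by simp
  have "transpose_mat ?A = ?A" using assms by (simp add: transpose_mult[of _ n2 n1 _ n2])
  then obtain es where es: "char_poly ?A = (\<Prod>e\<leftarrow>es. [:- e, 1:])"
    using symmetric_char_poly_splits[OF A] by blast
  then have "mset (gram_eigs_desc X) = mset es"
    by (simp add: mset_gram_eigs_desc proots_linear_factors)
  then have "mset (map (\<lambda>e. [:- e, 1:]) (gram_eigs_desc X)) = mset (map (\<lambda>e. [:- e, 1:]) es)"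
    by simp
  then show eq: "char_poly ?A = (\<Prod>e\<leftarrow>gram_eigs_desc X. [:- e, 1:])"
    unfolding es by (metis prod_mset_prod_list)
  have "degree (\<Prod>e\<leftarrow>es. [:- e, 1:]) = length es" for es :: "real list"
    by (rule degree_linear_factors)
  then show "length (gram_eigs_desc X) = n2"
    using eq degree_monic_char_poly[OF A] by simp
qed

text \<open>Diagonalizing the Gram matrix along the sorted list of its eigenvalues puts
  \<open>sing_val (Suc i) X\<close> at the 0-based position i. Each eigenvalue is nonnegative, being
  the squared length of a column of X V.\<close>

lemma ex_right_singular_system:
  assumes X: "X \<in> carrier_mat n1 n2"
  shows "\<exists>V. right_singular_system n1 n2 X V (\<lambda>i. sing_val (Suc i) X)"
proof -
  let ?A = "transpose_mat X * X"
  have A: "?A \<in> carrier_mat n2 n2" using X by simp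
  have sym: "transpose_mat ?A = ?A" using X by (simp add: transpose_mult[of _ n2 n1 _ n2])
  obtain V where V: "V \<in> carrier_mat n2 n2" "transpose_mat V * V = 1\<^sub>m n2"
    "transpose_mat V * ?A * V = mat_diag n2 (\<lambda>i. gram_eigs_desc X ! i)"
    using symmetric_orthogonal_diagonalization[OF A sym char_poly_gram(1)[OF X]] by blast
  have "transpose_mat V * ?A * V = transpose_mat (X * V) * (X * V)"
    using X V(1) by (simp add: transpose_mult[of _ n1 n2 _ n2] assoc_mult_mat[of _ n2 n1 _ n2 _ n2]
        assoc_mult_mat[of _ n2 n2 _ n2 _ n2] assoc_mult_mat[of _ n2 n2 _ n1 _ n2])
  then have g: "transpose_mat (X * V) * (X * V) = mat_diag n2 (\<lambda>i. gram_eigs_desc X ! i)"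
    using V(3) by simp
  have nonneg: "0 \<le> gram_eigs_desc X ! i" if i: "i < n2" for i
  proof -
    have "gram_eigs_desc X ! i = col (X * V) i \<bullet> col (X * V) i"
      using arg_cong[OF g, of "\<lambda>M. M $$ (i, i)"] i X V(1) by (simp add: mat_diag_def)
    then show ?thesis using conjugate_square_ge_0_vec[of "col (X * V) i"] by simp
  qed
  have sv: "(sing_val (Suc i) X)\<^sup>2 = gram_eigs_desc X ! i" if "i < n2" for i
    using that nonneg[OF that] char_poly_gram(2)[OF X] by (simp add: sing_val_def)
  have "mat_diag n2 (\<lambda>i. gram_eigs_desc X ! i) = mat_diag n2 (\<lambda>i. (sing_val (Suc i) X)\<^sup>2)"
    by (rule eq_matI) (auto simp: mat_diag_def sv)
  moreover have "0 \<le> sing_val (Suc i) X" if "i < n2" for i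
    using that nonneg char_poly_gram(2)[OF X] by (simp add: sing_val_def)
  ultimately show ?thesis
    using X V g unfolding right_singular_system_def by metis
qed

lemma sing_val_gt_dim_col:
  assumes "X \<in> carrier_mat n1 n2" "n2 < i"
  shows "sing_val i X = 0"
  using assms char_poly_gram(2) by (simp add: sing_val_def)

lemma sing_val_nonneg:
  assumes X: "X \<in> carrier_mat n1 n2"
  shows "0 \<le> sing_val i X"
proof (cases "1 \<le> i \<and> i \<le> n2")
  case True
  then obtain j where "i = Suc j" "j < n2" by (cases i) auto
  then show ?thesis
    using ex_right_singular_system[OF X] right_singular_systemD(5) by blast
next
  case False
  then show ?thesis using char_poly_gram(2)[OF X] by (auto simp: sing_val_def)
qed

lemma sing_val_antimono:
  assumes X: "X \<in> carrier_mat n1 n2" and ij: "1 \<le> i" "i \<le> j"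
  shows "sing_val j X \<le> sing_val i X"
proof (cases "j \<le> n2")
  case True
  have "sorted_wrt (\<ge>) (gram_eigs_desc X)"
    by (simp add: gram_eigs_desc_def sorted_wrt_rev)
  then have "gram_eigs_desc X ! (j - 1) \<le> gram_eigs_desc X ! (i - 1)"
    using ij True char_poly_gram(2)[OF X]
    by (cases "i = j") (auto simp: sorted_wrt_iff_nth_less)
  then show ?thesis
    using ij True char_poly_gram(2)[OF X] by (simp add: sing_val_def)
next
  case False
  then show ?thesis using sing_val_gt_dim_col[OF X] sing_val_nonneg[OF X] by simp
qed

text \<open>The squares of \<open>s\<close> are the diagonal of a matrix similar to the Gram matrix,
  so they are its eigenvalues with multiplicity. Hence any system, in whatever order, determines the
  singular values.\<close>

lemma mset_right_singular_system:
  assumes "right_singular_system n1 n2 X V s"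
  shows "mset (map s [0..<n2]) = mset (map (\<lambda>i. sing_val (Suc i) X) [0..<n2])"
proof -
  note D = right_singular_systemD[OF assms]
  let ?D = "mat_diag n2 (\<lambda>i. (s i)\<^sup>2)"
  have "transpose_mat (X * V) * (X * V) = transpose_mat V * (transpose_mat X * X) * V"
    using D(1,2) by (simp add: transpose_mult[of _ n1 n2 _ n2] assoc_mult_mat[of _ n2 n1 _ n2 _ n2]
        assoc_mult_mat[of _ n2 n2 _ n2 _ n2] assoc_mult_mat[of _ n2 n2 _ n1 _ n2])
  then have eq: "?D = transpose_mat V * (transpose_mat X * X) * V" using D(6) by simp
  have "similar_mat_wit ?D (transpose_mat X * X) (transpose_mat V) V"
    by (rule similar_mat_witI[of _ _ n2]) (use D eq in auto)
  then have "char_poly (transpose_mat X * X) = char_poly ?D"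
    by (intro char_poly_similar[symmetric]) (auto simp: similar_mat_def)
  also have "\<dots> = (\<Prod>a\<leftarrow>diag_mat ?D. [:- a, 1:])"
    by (rule char_poly_upper_triangular[of _ n2]) (auto simp: mat_diag_def)
  also have "diag_mat ?D = map (\<lambda>i. (s i)\<^sup>2) [0..<n2]"
    by (auto simp: diag_mat_def mat_diag_def)
  finally have "mset (gram_eigs_desc X) = mset (map (\<lambda>i. (s i)\<^sup>2) [0..<n2])"
    by (simp only: mset_gram_eigs_desc proots_linear_factors)
  then have "mset (map sqrt (gram_eigs_desc X)) = mset (map sqrt (map (\<lambda>i. (s i)\<^sup>2) [0..<n2]))"
    by (metis mset_map)
  moreover have "map sqrt (map (\<lambda>i. (s i)\<^sup>2) [0..<n2]) = map s [0..<n2]"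
    using D(5) by simp
  moreover have "map sqrt (gram_eigs_desc X) = map (\<lambda>i. sing_val (Suc i) X) [0..<n2]"
    by (rule nth_equalityI) (use char_poly_gram(2)[OF D(1)] in \<open>auto simp: sing_val_def\<close>)
  ultimately show ?thesis by metis
qed

text \<open>Dimension count: were singular value k + 1 positive, C G would be injective on the span
  of the first k + 1 right singular vectors, but \<open>G\<close> has only k rows and kills a
  nonzero vector there.\<close>

lemma sing_val_mult_eq_0:
  assumes C: "C \<in> carrier_mat n1 k" and G: "G \<in> carrier_mat k n2" and i: "k < i"
  shows "sing_val i (C * G) = 0"
proof (rule ccontr)
  let ?X = "C * G"
  assume "sing_val i ?X \<noteq> 0"
  have X: "?X \<in> carrier_mat n1 n2" using C G by simp
  have kn: "k < n2" using sing_val_gt_dim_col[OF X, of i] \<open>sing_val i ?X \<noteq> 0\<close> i by force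
  have pos: "sing_val (Suc j) ?X > 0" if "j \<le> k" for j
    using sing_val_antimono[OF X, of "Suc j" i] sing_val_nonneg[OF X, of i] that i
      \<open>sing_val i ?X \<noteq> 0\<close> by simp
  obtain V where V: "right_singular_system n1 n2 ?X V (\<lambda>i. sing_val (Suc i) ?X)"
    using ex_right_singular_system[OF X] by blast
  note D = right_singular_systemD[OF V]
  define P where "P = G * V"
  have P: "P \<in> carrier_mat k n2" using G D(2) by (simp add: P_def)
  define G' where "G' = mat k (Suc k) (\<lambda>(i, j). P $$ (i, j))"
  have G': "G' \<in> carrier_mat k (Suc k)" by (simp add: G'_def)
  obtain a where a: "a \<in> carrier_vec (Suc k)" "a \<noteq> 0\<^sub>v (Suc k)" "G' *\<^sub>v a = 0\<^sub>v k"
    using wide_mat_kernel[OF G'] by auto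
  \<comment> \<open>The kernel vector padded with zeros: coordinates in the basis V of a vector in
    the span of the first k + 1 columns.\<close>
  define b where "b = vec n2 (\<lambda>i. if i \<le> k then a $ i else 0)"
  have b: "b \<in> carrier_vec n2" by (simp add: b_def)
  have "P *\<^sub>v b = 0\<^sub>v k"
  proof (rule eq_vecI)
    fix i assume "i < dim_vec (0\<^sub>v k :: real vec)"
    then have i: "i < k" by simp
    have "(P *\<^sub>v b) $ i = (\<Sum>j<n2. P $$ (i, j) * (if j < Suc k then a $ j else 0))"
      using i P by (auto simp: scalar_prod_def b_def lessThan_atLeast0 less_Suc_eq_le intro!: sum.cong)
    also have "\<dots> = (\<Sum>j<Suc k. P $$ (i, j) * a $ j)"
      by (rule sum.mono_neutral_cong_right) (use kn in auto)
    also have "\<dots> = (G' *\<^sub>v a) $ i"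
      using i a(1) by (auto simp: scalar_prod_def G'_def lessThan_atLeast0 intro!: sum.cong)
    finally show "(P *\<^sub>v b) $ i = 0\<^sub>v k $ i" using a(3) i by simp
  qed (use P in simp)
  then have "?X *\<^sub>v (V *\<^sub>v b) = 0\<^sub>v n1"
    using C G D(2) b unfolding P_def
    by (simp add: assoc_mult_mat_vec[of _ n1 k _ n2] assoc_mult_mat_vec[of _ k n2 _ n2]
        mult_mat_zero_vec)
  then have "(\<Sum>i<n2. (sing_val (Suc i) ?X)\<^sup>2 * (b $ i)\<^sup>2) = 0"
    using right_singular_system_gram[OF V b] by simp
  then have z: "\<forall>i<n2. (sing_val (Suc i) ?X)\<^sup>2 * (b $ i)\<^sup>2 = 0"
    by (subst (asm) sum_nonneg_eq_0_iff) auto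
  have "a $ i = 0" if "i \<le> k" for i
    using pos[OF that] that kn z[rule_format, of i] by (simp add: b_def)
  then show False using a by (metis eq_vecI carrier_vecD index_zero_vec less_Suc_eq_le)
qed

lemma sing_val_gt_dim_row:
  assumes X: "X \<in> carrier_mat n1 n2" and "n1 < i"
  shows "sing_val i X = 0"
  using sing_val_mult_eq_0[of "1\<^sub>m n1" n1 n1 X n2 i] assms by simp

lemma sing_val_gt_rank:
  assumes X: "X \<in> carrier_mat n1 n2" and "vec_space.rank n1 X < i"
  shows "sing_val i X = 0"
  using rank_factorization[OF X] sing_val_mult_eq_0 assms(2) by metis

lemma sum_sing_val_shift: "(\<Sum>i = 1..k. sing_val i X) = (\<Sum>i<k. sing_val (Suc i) X)"
  by (simp add: sum.shift_bounds_cl_Suc_ivl[of _ 0] sum.atLeast1_atMost_eq lessThan_atLeast0)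

text \<open>A right singular system carries n2 values, the definition sums min(n1, n2) of them; the
  surplus ones vanish since the rank is at most n1.\<close>

lemma nuclear_norm_eq_sum:
  assumes X: "X \<in> carrier_mat n1 n2"
  shows "nuclear_norm X = (\<Sum>i<n2. sing_val (Suc i) X)"
proof -
  have "nuclear_norm X = (\<Sum>i<min n1 n2. sing_val (Suc i) X)"
    unfolding nuclear_norm_def sum_sing_val_shift using X by simp
  also have "\<dots> = (\<Sum>i<n2. sing_val (Suc i) X)"
    by (rule sum.mono_neutral_left) (auto simp: sing_val_gt_dim_row[OF X])
  finally show ?thesis .
qed

lemma nuclear_norm_right_singular_system:
  assumes "right_singular_system n1 n2 X V s"
  shows "nuclear_norm X = (\<Sum>i<n2. s i)"
proof -
  have "sum_list (map s [0..<n2]) = sum_list (map (\<lambda>i. sing_val (Suc i) X) [0..<n2])"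
    using mset_right_singular_system[OF assms] by (metis sum_mset_sum_list)
  then show ?thesis
    using nuclear_norm_eq_sum[OF right_singular_systemD(1)[OF assms]]
    by (simp add: interv_sum_list_conv_sum_set_nat lessThan_atLeast0)
qed

subsection \<open>Duality with contractions\<close>

text \<open>The Frobenius inner product trace(A^T B); each entry of \<open>meas\<close> has this
  form.\<close>

definition mat_inner :: "real mat \<Rightarrow> real mat \<Rightarrow> real" where
  "mat_inner A B = (\<Sum>i<dim_row A. \<Sum>j<dim_col A. A $$ (i, j) * B $$ (i, j))"

text \<open>Spectral norm at most 1, stated through squared lengths to stay free of square roots and
  operator norms.\<close>

definition contraction :: "nat \<Rightarrow> nat \<Rightarrow> real mat \<Rightarrow> bool" where
  "contraction n1 n2 L \<longleftrightarrow> L \<in> carrier_mat n1 n2 \<and>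
     (\<forall>z \<in> carrier_vec n2. (L *\<^sub>v z) \<bullet> (L *\<^sub>v z) \<le> z \<bullet> z)"

lemma contractionD:
  assumes "contraction n1 n2 L"
  shows "L \<in> carrier_mat n1 n2" "\<And>z. z \<in> carrier_vec n2 \<Longrightarrow> (L *\<^sub>v z) \<bullet> (L *\<^sub>v z) \<le> z \<bullet> z"
  using assms by (auto simp: contraction_def)

lemma mat_inner_add_right:
  assumes "A \<in> carrier_mat n1 n2" "B \<in> carrier_mat n1 n2" "C \<in> carrier_mat n1 n2"
  shows "mat_inner A (B + C) = mat_inner A B + mat_inner A C"
  using assms by (simp add: mat_inner_def algebra_simps sum.distrib)

lemma mat_inner_minus_left:
  assumes "A \<in> carrier_mat n1 n2" "B \<in> carrier_mat n1 n2" "C \<in> carrier_mat n1 n2"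
  shows "mat_inner (A - B) C = mat_inner A C - mat_inner B C"
  using assms by (simp add: mat_inner_def algebra_simps sum_subtractf)

lemma mat_inner_smult_left: "mat_inner (a \<cdot>\<^sub>m A) B = a * mat_inner A B"
  by (simp add: mat_inner_def sum_distrib_left mult.assoc)

lemma mat_inner_commute:
  assumes "A \<in> carrier_mat n1 n2" "B \<in> carrier_mat n1 n2"
  shows "mat_inner A B = mat_inner B A"
  using assms by (simp add: mat_inner_def mult.commute)

lemma frob_norm_sq: "(frob_norm X)\<^sup>2 = mat_inner X X"
  unfolding frob_norm_def mat_inner_def
  by (subst real_sqrt_pow2) (auto intro!: sum_nonneg simp: power2_eq_square)

lemma mat_inner_self_pos:
  assumes X: "X \<in> carrier_mat n1 n2" "X \<noteq> 0\<^sub>m n1 n2"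
  shows "0 < mat_inner X X"
proof -
  obtain i j where ij: "i < n1" "j < n2" "X $$ (i, j) \<noteq> 0"
    using X by (metis carrier_matD eq_matI index_zero_mat)
  have "0 < (\<Sum>j<n2. X $$ (i, j) * X $$ (i, j))"
    by (rule sum_pos2[of _ j]) (use ij in \<open>auto simp: zero_less_mult_iff linorder_neq_iff\<close>)
  then have "0 < (\<Sum>i<n1. \<Sum>j<n2. X $$ (i, j) * X $$ (i, j))"
    by (rule sum_pos2[of _ i, rotated 2]) (use ij in \<open>auto intro!: sum_nonneg\<close>)
  then show ?thesis using X by (simp add: mat_inner_def)
qed

text \<open>trace(A V V^T B^T) = trace(A B^T). Choosing V as the right singular basis of one
  argument turns inner products into sums over singular values.\<close>

lemma mat_inner_orthonormal_basis:
  assumes A: "A \<in> carrier_mat n1 n2" and B: "B \<in> carrier_mat n1 n2"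
    and V: "V \<in> carrier_mat n2 n2" "V * transpose_mat V = 1\<^sub>m n2"
  shows "mat_inner A B = (\<Sum>i<n2. (A *\<^sub>v col V i) \<bullet> (B *\<^sub>v col V i))"
proof -
  define P where "P = A * V"
  define Q where "Q = B * V"
  have P: "P \<in> carrier_mat n1 n2" and Q: "Q \<in> carrier_mat n1 n2"
    using A B V by (auto simp: P_def Q_def)
  have "(\<Sum>i<n2. (A *\<^sub>v col V i) \<bullet> (B *\<^sub>v col V i)) = (\<Sum>i<n2. col P i \<bullet> col Q i)"
    using A B V by (simp add: P_def Q_def)
  also have "\<dots> = (\<Sum>i<n2. \<Sum>k<n1. P $$ (k, i) * Q $$ (k, i))"
    using P Q by (simp add: scalar_prod_def lessThan_atLeast0)
  also have "\<dots> = (\<Sum>k<n1. \<Sum>i<n2. P $$ (k, i) * Q $$ (k, i))"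
    by (rule sum.swap)
  also have "\<dots> = (\<Sum>k<n1. (P * transpose_mat Q) $$ (k, k))"
    using P Q by (simp add: scalar_prod_def lessThan_atLeast0)
  also have "P * transpose_mat Q = A * (V * transpose_mat V) * transpose_mat B"
    using A B V(1) by (simp add: P_def Q_def transpose_mult[of _ n1 n2 _ n2]
        assoc_mult_mat[of _ n1 n2 _ n2 _ n1] assoc_mult_mat[of _ n1 n2 _ n2 _ n2]
        assoc_mult_mat[of _ n2 n2 _ n2 _ n1])
  also have "\<dots> = A * transpose_mat B" using A V by simp
  also have "(\<Sum>k<n1. (A * transpose_mat B) $$ (k, k)) = mat_inner A B"
    using A B by (simp add: mat_inner_def scalar_prod_def lessThan_atLeast0)
  finally show ?thesis by simp
qed

section \<open>Trace duality between contractions and the nuclear norm\<close>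

lemma scalar_prod_self_nonneg: "0 \<le> (x :: real vec) \<bullet> x"
  by (simp add: scalar_prod_def sum_nonneg)

text \<open>Cauchy-Schwarz with the length of y supplied as s: expand the squared length of s x - y
  and divide by s, which needs s = 0 to be treated apart.\<close>

lemma scalar_prod_le_norm:
  fixes x y :: "real vec"
  assumes "x \<in> carrier_vec n" "y \<in> carrier_vec n" "x \<bullet> x \<le> 1" "y \<bullet> y = s\<^sup>2" "0 \<le> s"
  shows "x \<bullet> y \<le> s"
proof (cases "s = 0")
  case True
  then have "y = 0\<^sub>v n" using assms conjugate_square_eq_0_vec[of y n] by simp
  then show ?thesis using assms True by simp
next
  case False
  have "0 \<le> (s \<cdot>\<^sub>v x - y) \<bullet> (s \<cdot>\<^sub>v x - y)" by (rule scalar_prod_self_nonneg)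
  also have "\<dots> = s * s * (x \<bullet> x) - 2 * s * (x \<bullet> y) + y \<bullet> y"
    using assms(1,2) comm_scalar_prod[OF assms(1,2)]
    by (simp add: minus_scalar_prod_distrib[of _ n] scalar_prod_minus_distrib[of _ n] algebra_simps)
  also have "\<dots> \<le> s * s * 1 - 2 * s * (x \<bullet> y) + s * s"
    using assms by (intro add_mono diff_right_mono mult_left_mono) (auto simp: power2_eq_square)
  finally have "2 * s * (x \<bullet> y) \<le> 2 * s * s" by simp
  then show ?thesis using False assms(5) by simp
qed

text \<open>In the right singular basis of Y, every term (L v_i) . (Y v_i) is at most the length of
  Y v_i, which is the singular value.\<close>

lemma contraction_inner_le_nuclear_norm:
  assumes L: "contraction n1 n2 L" and Y: "Y \<in> carrier_mat n1 n2"
  shows "mat_inner L Y \<le> nuclear_norm Y"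
proof -
  obtain V where V: "right_singular_system n1 n2 Y V (\<lambda>i. sing_val (Suc i) Y)"
    using ex_right_singular_system[OF Y] by blast
  note D = right_singular_systemD[OF V]
  note CD = contractionD[OF L]
  have "mat_inner L Y = (\<Sum>i<n2. (L *\<^sub>v col V i) \<bullet> (Y *\<^sub>v col V i))"
    by (rule mat_inner_orthonormal_basis[OF CD(1) Y D(2,4)])
  also have "\<dots> \<le> (\<Sum>i<n2. sing_val (Suc i) Y)"
  proof (rule sum_mono)
    fix i assume "i \<in> {..<n2}"
    then have i: "i < n2" by simp
    have v: "col V i \<in> carrier_vec n2" using i D(2) by simp
    have L1: "(L *\<^sub>v col V i) \<bullet> (L *\<^sub>v col V i) \<le> 1"
      using CD(2)[OF v] orthogonal_cols[OF D(2,3) i i] by simp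
    have YY: "(Y *\<^sub>v col V i) \<bullet> (Y *\<^sub>v col V i) = (sing_val (Suc i) Y)\<^sup>2"
      using right_singular_system_cols[OF V i i] by simp
    show "(L *\<^sub>v col V i) \<bullet> (Y *\<^sub>v col V i) \<le> sing_val (Suc i) Y"
      by (rule scalar_prod_le_norm[OF mult_mat_vec_carrier[OF CD(1) v]
            mult_mat_vec_carrier[OF Y v] L1 YY D(5)[OF i]])
  qed
  also have "\<dots> = nuclear_norm Y" using nuclear_norm_eq_sum[OF Y] by simp
  finally show ?thesis .
qed

lemma right_singular_system_contraction:
  assumes V: "right_singular_system n1 n2 X V s" and le: "\<And>i. i < n2 \<Longrightarrow> s i \<le> 1"
  shows "contraction n1 n2 X"
  unfolding contraction_def
proof (intro conjI ballI)
  note D = right_singular_systemD[OF V]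
  show "X \<in> carrier_mat n1 n2" by (rule D(1))
  fix z :: "real vec" assume z: "z \<in> carrier_vec n2"
  define b where "b = transpose_mat V *\<^sub>v z"
  have b: "b \<in> carrier_vec n2" using D(2) z by (simp add: b_def)
  have Vb: "V *\<^sub>v b = z"
    unfolding b_def using D(2,4) z by (simp flip: assoc_mult_mat_vec[of _ n2 n2 _ n2])
  have "(X *\<^sub>v z) \<bullet> (X *\<^sub>v z) = (\<Sum>i<n2. (s i)\<^sup>2 * (b $ i)\<^sup>2)"
    using right_singular_system_gram[OF V b] Vb by simp
  also have "\<dots> \<le> (\<Sum>i<n2. 1 * (b $ i)\<^sup>2)"
    using le D(5) by (intro sum_mono mult_right_mono) (auto simp: power_le_one)
  also have "\<dots> = b \<bullet> b" using b by (simp add: scalar_prod_def power2_eq_square lessThan_atLeast0)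
  also have "\<dots> = (V *\<^sub>v b) \<bullet> (V *\<^sub>v b)"
    using scalar_prod_mult_mat_vec[OF D(2,2) b b] D(3) b by simp
  finally show "(X *\<^sub>v z) \<bullet> (X *\<^sub>v z) \<le> z \<bullet> z" using Vb by simp
qed

lemma contraction_sing_val_le_1:
  assumes L: "contraction n1 n2 L" and V: "right_singular_system n1 n2 L V s" and i: "i < n2"
  shows "s i \<le> 1"
proof -
  note D = right_singular_systemD[OF V]
  have v: "col V i \<in> carrier_vec n2" using i D(2) by simp
  have "(s i)\<^sup>2 \<le> 1"
    using contractionD(2)[OF L v] right_singular_system_cols[OF V i i]
      orthogonal_cols[OF D(2,3) i i] by simp
  then show ?thesis by (metis abs_le_square_iff abs_one abs_ge_self order_trans power_one)
qed

text \<open>For a right singular system this is the sum of g(i) (X v_i) v_i^T: the i-th singular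
  component is multiplied by g(i), sign included. Polar factors, truncations and multiples of X all
  have this shape and share V with X.\<close>

definition rescale :: "nat \<Rightarrow> real mat \<Rightarrow> real mat \<Rightarrow> (nat \<Rightarrow> real) \<Rightarrow> real mat" where
  "rescale n2 X V g = X * (V * mat_diag n2 g * transpose_mat V)"

lemma rescale_carrier:
  assumes "X \<in> carrier_mat n1 n2" "V \<in> carrier_mat n2 n2"
  shows "rescale n2 X V g \<in> carrier_mat n1 n2"
  using assms by (intro carrier_matI) (simp_all add: rescale_def)

lemma rescale_mult:
  assumes V: "right_singular_system n1 n2 X V s"
  shows "rescale n2 X V g * V = X * V * mat_diag n2 g"
proof -
  note D = right_singular_systemD[OF V]
  define G where "G = mat_diag n2 g"
  have G: "G \<in> carrier_mat n2 n2" by (simp add: G_def)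
  have "X * (V * G * transpose_mat V) * V = X * V * G * (transpose_mat V * V)"
    using D(1,2) G by (simp add:
        assoc_mult_mat[of _ n1 n2 _ n2 _ n2] assoc_mult_mat[of _ n2 n2 _ n2 _ n2])
  also have "\<dots> = X * V * G" using D(1,2) G unfolding D(3) by simp
  finally show ?thesis by (simp add: rescale_def G_def)
qed

lemma right_singular_system_rescale:
  assumes V: "right_singular_system n1 n2 X V s"
  shows "right_singular_system n1 n2 (rescale n2 X V g) V (\<lambda>i. \<bar>g i\<bar> * s i)"
proof -
  note D = right_singular_systemD[OF V]
  define G where "G = mat_diag n2 g"
  have G: "G \<in> carrier_mat n2 n2" by (simp add: G_def)
  have Gt: "transpose_mat G = G" by (rule eq_matI) (auto simp: mat_diag_def G_def)
  define P where "P = X * V"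
  have P: "P \<in> carrier_mat n1 n2" using D(1,2) by (simp add: P_def)
  have "transpose_mat (rescale n2 X V g * V) * (rescale n2 X V g * V)
      = G * (transpose_mat P * P) * G"
    unfolding rescale_mult[OF V] P_def[symmetric] G_def[symmetric] using P G Gt
    by (simp add: transpose_mult[of _ n1 n2 _ n2] assoc_mult_mat[of _ n2 n1 _ n2 _ n2]
        assoc_mult_mat[of _ n2 n2 _ n2 _ n2] assoc_mult_mat[of _ n2 n2 _ n1 _ n2])
  also have "\<dots> = mat_diag n2 (\<lambda>i. (\<bar>g i\<bar> * s i)\<^sup>2)"
    unfolding P_def D(6) G_def by (simp add: power_mult_distrib power2_eq_square mult_ac)
  finally show ?thesis
    using D(2,3,5) rescale_carrier[OF D(1,2)] by (auto simp: right_singular_system_def)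
qed

lemma rescale_col:
  assumes V: "right_singular_system n1 n2 X V s" and i: "i < n2"
  shows "rescale n2 X V g *\<^sub>v col V i = g i \<cdot>\<^sub>v (X *\<^sub>v col V i)"
proof -
  note D = right_singular_systemD[OF V]
  have R: "rescale n2 X V g \<in> carrier_mat n1 n2" by (rule rescale_carrier[OF D(1,2)])
  have "rescale n2 X V g *\<^sub>v col V i = col (rescale n2 X V g * V) i"
    using R D(2) i by simp
  also have "\<dots> = col (X * V * mat_diag n2 g) i" by (simp add: rescale_mult[OF V])
  also have "\<dots> = g i \<cdot>\<^sub>v col (X * V) i"
    using D(1,2) i by (auto simp: mat_diag_mult_right[of _ n1 n2] intro!: eq_vecI simp del: col_mult)
  finally show ?thesis using D(1,2) i by simp
qed

lemma mat_inner_rescale_right: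
  assumes V: "right_singular_system n1 n2 X V s" and M: "M \<in> carrier_mat n1 n2"
  shows "mat_inner M (rescale n2 X V g) = (\<Sum>i<n2. g i * ((M *\<^sub>v col V i) \<bullet> (X *\<^sub>v col V i)))"
proof -
  note D = right_singular_systemD[OF V]
  have R: "rescale n2 X V g \<in> carrier_mat n1 n2" by (rule rescale_carrier[OF D(1,2)])
  show ?thesis
    unfolding mat_inner_orthonormal_basis[OF M R D(2,4)]
    by (rule sum.cong) (use D(1,2) M in \<open>auto simp: rescale_col[OF V]\<close>)
qed

text \<open>Fractional knapsack: weights in [0, 1] of total at most k do best on the k largest
  values.\<close>

lemma sum_weighted_le_top:
  fixes s w :: "nat \<Rightarrow> real"
  assumes anti: "\<And>i j. i \<le> j \<Longrightarrow> s j \<le> s i" and s0: "\<And>i. 0 \<le> s i"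
    and w: "\<And>i. i < n \<Longrightarrow> 0 \<le> w i" "\<And>i. i < n \<Longrightarrow> w i \<le> 1" and sw: "(\<Sum>i<n. w i) \<le> real k"
  shows "(\<Sum>i<n. s i * w i) \<le> (\<Sum>i<k. s i)"
proof (cases "n \<le> k")
  case True
  have "(\<Sum>i<n. s i * w i) \<le> (\<Sum>i<n. s i)"
    using s0 w by (intro sum_mono) (simp add: mult_left_le)
  also have "\<dots> \<le> (\<Sum>i<k. s i)" using True s0 by (intro sum_mono2) auto
  finally show ?thesis .
next
  case False
  \<comment> \<open>With \<open>s k\<close> as threshold, indices below k contribute at most s_i -
    s_k and the others contribute nothing positive.\<close>
  have "(\<Sum>i<n. (s i - s k) * w i) \<le> (\<Sum>i<n. if i < k then s i - s k else 0)"
  proof (rule sum_mono)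
    fix i assume "i \<in> {..<n}"
    then show "(s i - s k) * w i \<le> (if i < k then s i - s k else 0)"
      using anti[of i k] anti[of k i] w[of i]
      by (auto simp: mult_left_le mult_nonpos_nonneg)
  qed
  also have "\<dots> = (\<Sum>i<k. s i - s k)"
    using False by (intro sum.mono_neutral_cong_right) auto
  also have "\<dots> = (\<Sum>i<k. s i) - k * s k" by (simp add: sum_subtractf)
  finally have "(\<Sum>i<n. s i * w i) - s k * (\<Sum>i<n. w i) \<le> (\<Sum>i<k. s i) - k * s k"
    by (simp add: left_diff_distrib sum_subtractf sum_distrib_left)
  moreover have "s k * (\<Sum>i<n. w i) \<le> s k * k" using sw s0 by (intro mult_left_mono) auto
  ultimately show ?thesis by (simp add: mult.commute)
qed

text \<open>In the right singular basis of H the inner product is the sum of q_i with |q_i| at most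
  s_i. The ratios |q_i| / s_i are weights whose total is the inner product of M with a contraction,
  hence at most the nuclear norm of M, which is at most k; the knapsack bound finishes.\<close>

lemma ky_fan_bound:
  assumes M: "contraction n1 n2 M" and k: "\<And>i. k < i \<Longrightarrow> sing_val i M = 0"
    and H: "H \<in> carrier_mat n1 n2"
  shows "mat_inner M H \<le> (\<Sum>i = 1..k. sing_val i H)"
proof -
  let ?s = "\<lambda>i. sing_val (Suc i) H"
  obtain V where V: "right_singular_system n1 n2 H V ?s"
    using ex_right_singular_system[OF H] by blast
  note D = right_singular_systemD[OF V]
  note CD = contractionD[OF M]
  define q where "q i = (M *\<^sub>v col V i) \<bullet> (H *\<^sub>v col V i)" for i
  \<comment> \<open>Where the singular value is 0, division by zero makes the weight 0; there q_i is
    0 too, so nothing is lost.\<close>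
  define w where "w i = \<bar>q i\<bar> / ?s i" for i
  have s0: "0 \<le> ?s i" for i by (rule sing_val_nonneg[OF H])
  have w0: "0 \<le> w i" for i using s0 by (simp add: w_def)
  have q: "\<bar>q i\<bar> \<le> ?s i" if i: "i < n2" for i
  proof -
    have v: "col V i \<in> carrier_vec n2" using i D(2) by simp
    have Mv: "M *\<^sub>v col V i \<in> carrier_vec n1" and Hv: "H *\<^sub>v col V i \<in> carrier_vec n1"
      using v CD(1) H by auto
    have M1: "(M *\<^sub>v col V i) \<bullet> (M *\<^sub>v col V i) \<le> 1"
      using CD(2)[OF v] orthogonal_cols[OF D(2,3) i i] by simp
    have HH: "(H *\<^sub>v col V i) \<bullet> (H *\<^sub>v col V i) = (?s i)\<^sup>2"
      using right_singular_system_cols[OF V i i] by simp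
    \<comment> \<open>Cauchy-Schwarz applied to \<open>- y\<close> supplies the lower bound for
      q_i.\<close>
    define y where "y = H *\<^sub>v col V i"
    have y: "y \<in> carrier_vec n1" "- y \<in> carrier_vec n1" using Hv by (simp_all add: y_def)
    have yy: "(- y) \<bullet> (- y) = (?s i)\<^sup>2" using HH by (simp add: y_def)
    have "q i \<le> ?s i"
      unfolding q_def by (rule scalar_prod_le_norm[OF Mv Hv M1 HH s0])
    moreover have "(M *\<^sub>v col V i) \<bullet> (- y) \<le> ?s i"
      by (rule scalar_prod_le_norm[OF Mv y(2) M1 yy s0])
    moreover have "(M *\<^sub>v col V i) \<bullet> (- y) = - q i"
      unfolding q_def y_def using CD(1) H by (intro scalar_prod_uminus_right) simp
    ultimately show ?thesis by linarith
  qed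
  have w1: "w i \<le> 1" if "i < n2" for i
    using q[OF that] s0[of i] by (auto simp: w_def divide_le_eq_1)
  \<comment> \<open>Signs over singular values make \<open>?P\<close> a partial isometry whose inner
    product with M is the sum of the weights.\<close>
  define g where "g i = sgn (q i) / ?s i" for i
  let ?P = "rescale n2 H V g"
  have P: "contraction n1 n2 ?P"
    by (rule right_singular_system_contraction[OF right_singular_system_rescale[OF V]])
      (use s0 in \<open>auto simp: g_def abs_mult abs_sgn_eq\<close>)
  obtain U where U: "right_singular_system n1 n2 M U (\<lambda>i. sing_val (Suc i) M)"
    using ex_right_singular_system[OF CD(1)] by blast
  have "(\<Sum>i<n2. w i) = (\<Sum>i<n2. g i * q i)"
    by (rule sum.cong) (auto simp: w_def g_def abs_sgn mult.commute)
  also have "\<dots> = mat_inner M ?P"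
    unfolding mat_inner_rescale_right[OF V CD(1)] q_def ..
  also have "\<dots> = mat_inner ?P M"
    using CD(1) contractionD(1)[OF P] by (rule mat_inner_commute)
  also have "\<dots> \<le> nuclear_norm M"
    by (rule contraction_inner_le_nuclear_norm[OF P CD(1)])
  also have "\<dots> = (\<Sum>i<n2. sing_val (Suc i) M)" by (rule nuclear_norm_eq_sum[OF CD(1)])
  also have "\<dots> \<le> (\<Sum>i<n2. if i < k then 1 else 0)"
    by (rule sum_mono) (use k contraction_sing_val_le_1[OF M U] in auto)
  also have "\<dots> = real (card ({..<n2} \<inter> {i. i < k}))" by (simp add: sum.If_cases)
  also have "\<dots> \<le> real (card {..<k})" by (intro of_nat_mono card_mono) auto
  also have "\<dots> = real k" by simp
  finally have sw: "(\<Sum>i<n2. w i) \<le> real k" .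
  have "mat_inner M H = (\<Sum>i<n2. q i)"
    unfolding q_def by (rule mat_inner_orthonormal_basis[OF CD(1) H D(2,4)])
  also have "\<dots> \<le> (\<Sum>i<n2. ?s i * w i)"
  proof (rule sum_mono)
    fix i assume "i \<in> {..<n2}"
    then show "q i \<le> ?s i * w i" using q[of i] by (auto simp: w_def)
  qed
  also have "\<dots> \<le> (\<Sum>i<k. ?s i)"
    using w0 w1 sw s0 by (intro sum_weighted_le_top) (auto intro: sing_val_antimono[OF H])
  also have "\<dots> = (\<Sum>i = 1..k. sing_val i H)" by (rule sum_sing_val_shift[symmetric])
  finally show ?thesis .
qed

subsection \<open>A feedback contraction\<close>

text \<open>The squared distance from y to its projection U U^T y is nonnegative.\<close>

lemma bessel:
  fixes U :: "real mat"
  assumes U: "U \<in> carrier_mat n k" "transpose_mat U * U = 1\<^sub>m k" and y: "y \<in> carrier_vec n"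
  shows "(transpose_mat U *\<^sub>v y) \<bullet> (transpose_mat U *\<^sub>v y) \<le> y \<bullet> y"
proof -
  define x where "x = transpose_mat U *\<^sub>v y"
  have x: "x \<in> carrier_vec k" using U y by (simp add: x_def)
  define z where "z = U *\<^sub>v x"
  have z: "z \<in> carrier_vec n" using U x by (simp add: z_def)
  have yz: "y \<bullet> z = x \<bullet> x"
    unfolding z_def x_def[symmetric] transpose_vec_mult_scalar[OF U(1) x y, symmetric] ..
  have zz: "z \<bullet> z = x \<bullet> x"
    unfolding z_def scalar_prod_mult_mat_vec[OF U(1,1) x x] U(2) using x by simp
  have "0 \<le> (y - z) \<bullet> (y - z)" by (rule scalar_prod_self_nonneg)
  also have "\<dots> = y \<bullet> y - 2 * (y \<bullet> z) + z \<bullet> z"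
    using y z comm_scalar_prod[OF y z]
    by (simp add: minus_scalar_prod_distrib[of _ n] scalar_prod_minus_distrib[of _ n])
  finally show ?thesis using yz zz by (simp add: x_def)
qed

lemma ex_inverse_mat:
  fixes N :: "'a :: field mat"
  assumes N: "N \<in> carrier_mat k k"
    and inj: "\<And>a. a \<in> carrier_vec k \<Longrightarrow> N *\<^sub>v a = 0\<^sub>v k \<Longrightarrow> a = 0\<^sub>v k"
  obtains N' where "N' \<in> carrier_mat k k" "N * N' = 1\<^sub>m k" "N' * N = 1\<^sub>m k"
proof -
  have "det N \<noteq> 0" using det_0_iff_vec_prod_zero_field[OF N] inj by blast
  then have "N \<in> Units (ring_mat TYPE('a) k undefined)" by (rule det_non_zero_imp_unit[OF N])
  then show thesis using that by (auto simp: Units_def ring_mat_def)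
qed

text \<open>The contraction \<open>L\<close> is the feedback connection of \<open>W\<close> that identifies the output
  along the columns of \<open>U\<close> with the input along those of \<open>V\<close>.\<close>
lemma feedback_contraction:
  fixes W U V :: "real mat"
  assumes W: "W \<in> carrier_mat n1 n2"
    and Wt: "\<And>z. z \<in> carrier_vec n2 \<Longrightarrow> (W *\<^sub>v z) \<bullet> (W *\<^sub>v z) \<le> t * (z \<bullet> z)" and t: "t < 1"
    and U: "U \<in> carrier_mat n1 k" "transpose_mat U * U = 1\<^sub>m k"
    and V: "V \<in> carrier_mat n2 k" "transpose_mat V * V = 1\<^sub>m k"
  obtains L C G where "contraction n1 n2 L" "L * V = U"
    "C \<in> carrier_mat n1 k" "G \<in> carrier_mat k n2" "W - L = C * G"
proof -
  let ?Ut = "transpose_mat U" and ?Vt = "transpose_mat V"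
  have Ut: "?Ut \<in> carrier_mat k n1" and Vt: "?Vt \<in> carrier_mat k n2" using U V by auto
  have W1: "(W *\<^sub>v z) \<bullet> (W *\<^sub>v z) \<le> z \<bullet> z" if z: "z \<in> carrier_vec n2" for z
  proof -
    have "t * (z \<bullet> z) \<le> 1 * (z \<bullet> z)"
      using t by (intro mult_right_mono scalar_prod_self_nonneg) simp
    then show ?thesis using Wt[OF z] by simp
  qed
  have isoV: "(V *\<^sub>v a) \<bullet> (V *\<^sub>v a) = a \<bullet> a" if "a \<in> carrier_vec k" for a
    unfolding scalar_prod_mult_mat_vec[OF V(1,1) that that] V(2) using that by simp
  have isoU: "(U *\<^sub>v a) \<bullet> (U *\<^sub>v a) = a \<bullet> a" if "a \<in> carrier_vec k" for a
    unfolding scalar_prod_mult_mat_vec[OF U(1,1) that that] U(2) using that by simp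
  define N where "N = 1\<^sub>m k - ?Ut * W * V"
  have N: "N \<in> carrier_mat k k" using U V W by (auto simp: N_def)
  have Nv: "N *\<^sub>v a = a - ?Ut *\<^sub>v (W *\<^sub>v (V *\<^sub>v a))" if a: "a \<in> carrier_vec k" for a
    unfolding N_def using a U V W Ut
    by (simp add: minus_mult_distrib_mat_vec[of _ k k] assoc_mult_mat_vec[of _ k n1 _ k]
        assoc_mult_mat_vec[of _ n1 n2 _ k])
  \<comment> \<open>A kernel vector satisfies a = U^T W V a, so by Bessel |a|^2 is at most |W V
    a|^2, hence at most t |a|^2; t < 1 forces a = 0.\<close>
  obtain N' where N': "N' \<in> carrier_mat k k" "N * N' = 1\<^sub>m k" "N' * N = 1\<^sub>m k"
  proof (rule ex_inverse_mat[OF N])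
    fix a assume a: "a \<in> carrier_vec k" and "N *\<^sub>v a = 0\<^sub>v k"
    define x where "x = ?Ut *\<^sub>v (W *\<^sub>v (V *\<^sub>v a))"
    have Va: "V *\<^sub>v a \<in> carrier_vec n2" using V a by simp
    have WVa: "W *\<^sub>v (V *\<^sub>v a) \<in> carrier_vec n1" using W Va by simp
    have x: "x \<in> carrier_vec k" using Ut WVa by (simp add: x_def)
    have ax: "a = x"
    proof (rule eq_vecI)
      fix i assume i: "i < dim_vec x"
      have "a - x = 0\<^sub>v k" using Nv[OF a] \<open>N *\<^sub>v a = 0\<^sub>v k\<close> by (simp add: x_def)
      then have "(a - x) $ i = 0\<^sub>v k $ i" by simp
      then show "a $ i = x $ i" using i a x by simp
    qed (use a x in simp)
    have "a \<bullet> a = x \<bullet> x" using ax by simp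
    also have "\<dots> \<le> (W *\<^sub>v (V *\<^sub>v a)) \<bullet> (W *\<^sub>v (V *\<^sub>v a))"
      unfolding x_def by (rule bessel[OF U WVa])
    also have "\<dots> \<le> t * (a \<bullet> a)" using Wt[OF Va] isoV[OF a] by simp
    finally have "(1 - t) * (a \<bullet> a) \<le> 0" by (simp add: algebra_simps)
    then have "a \<bullet> a = 0" using t scalar_prod_self_nonneg[of a] by (simp add: mult_le_0_iff)
    then show "a = 0\<^sub>v k" using conjugate_square_eq_0_vec[OF a] by simp
  qed
  define D where "D = ?Vt - ?Ut * W"
  define G where "G = N' * D"
  define C where "C = W * V - U"
  define L where "L = W - C * G"
  have D: "D \<in> carrier_mat k n2" using Ut Vt W by (auto simp: D_def)
  have G: "G \<in> carrier_mat k n2" using N' D by (simp add: G_def)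
  have C: "C \<in> carrier_mat n1 k" using W U V by (auto simp: C_def)
  have CG: "C * G \<in> carrier_mat n1 n2" using C G by simp
  have L: "L \<in> carrier_mat n1 n2" unfolding L_def by (rule minus_carrier_mat[OF CG])
  have diff: "W - L = C * G"
    by (rule eq_matI) (use W CG in \<open>auto simp: L_def\<close>)
  \<comment> \<open>Since V^T V = 1, D V is the loop matrix \<open>N\<close>, so G V = 1 and L V = W
    V - (W V - U) = U.\<close>
  have "G * V = N' * (D * V)" using N' D V by (simp add: G_def assoc_mult_mat[of _ k k _ n2 _ k])
  also have "D * V = N"
    unfolding D_def N_def using Vt Ut W V
    by (simp add: minus_mult_distrib_mat[of _ k n2 _ _ k])
  finally have GV: "G * V = 1\<^sub>m k" using N' by simp
  have "L * V = W * V - C * (G * V)"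
    unfolding L_def using W C G CG V
    by (simp add: minus_mult_distrib_mat[of _ n1 n2 _ _ k] assoc_mult_mat[of _ n1 k _ n2 _ k])
  also have "\<dots> = W * V - C" using C GV by simp
  also have "\<dots> = U" by (rule eq_matI) (use W V U in \<open>auto simp: C_def\<close>)
  finally have LV: "L * V = U" .
  have "(L *\<^sub>v z) \<bullet> (L *\<^sub>v z) \<le> z \<bullet> z" if z: "z \<in> carrier_vec n2" for z
  proof -
    \<comment> \<open>\<open>g\<close> is the loop signal and \<open>p\<close> the input left for W
      after feedback: z = p + V g and L z = W p + U g.\<close>
    define g where "g = G *\<^sub>v z"
    define p where "p = z - V *\<^sub>v g"
    have g: "g \<in> carrier_vec k" using G z by (simp add: g_def)
    have Vg: "V *\<^sub>v g \<in> carrier_vec n2" using V g by simp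
    have Ug: "U *\<^sub>v g \<in> carrier_vec n1" using U g by simp
    have p: "p \<in> carrier_vec n2" using z Vg by (simp add: p_def)
    have Wp: "W *\<^sub>v p \<in> carrier_vec n1" using W p by simp
    have Wz: "W *\<^sub>v z \<in> carrier_vec n1" and WVg: "W *\<^sub>v (V *\<^sub>v g) \<in> carrier_vec n1"
      using W z Vg by auto
    have Wp_eq: "W *\<^sub>v p = W *\<^sub>v z - W *\<^sub>v (V *\<^sub>v g)"
      unfolding p_def by (rule mult_minus_distrib_mat_vec[OF W z Vg])
    have "L *\<^sub>v z = W *\<^sub>v z - C *\<^sub>v g"
      unfolding L_def g_def using W CG C G z
      by (simp add: minus_mult_distrib_mat_vec[of _ n1 n2] assoc_mult_mat_vec[of _ n1 k _ n2])
    also have "C *\<^sub>v g = W *\<^sub>v (V *\<^sub>v g) - U *\<^sub>v g"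
      unfolding C_def using W V U g
      by (simp add: minus_mult_distrib_mat_vec[of _ n1 k] assoc_mult_mat_vec[of _ n1 n2 _ k])
    finally have Lz: "L *\<^sub>v z = W *\<^sub>v p + U *\<^sub>v g"
      unfolding Wp_eq using W U by (intro eq_vecI) auto
    have "N *\<^sub>v g = (N * N') *\<^sub>v (D *\<^sub>v z)"
      unfolding g_def G_def using N N'(1) D z
      by (simp add: assoc_mult_mat_vec[of _ k k _ n2] assoc_mult_mat_vec[of _ k k _ k])
    also have "\<dots> = D *\<^sub>v z" using N' D z by simp
    also have "\<dots> = ?Vt *\<^sub>v z - ?Ut *\<^sub>v (W *\<^sub>v z)"
      unfolding D_def using Vt Ut W z
      by (simp add: minus_mult_distrib_mat_vec[of _ k n2] assoc_mult_mat_vec[of _ k n1 _ n2])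
    finally have Ng: "g - ?Ut *\<^sub>v (W *\<^sub>v (V *\<^sub>v g)) = ?Vt *\<^sub>v z - ?Ut *\<^sub>v (W *\<^sub>v z)"
      using Nv[OF g] by simp
    have "?Vt *\<^sub>v p = ?Vt *\<^sub>v z - g"
    proof -
      have "?Vt *\<^sub>v (V *\<^sub>v g) = g"
        using assoc_mult_mat_vec[OF Vt V(1) g] V(2) g by simp
      then show ?thesis unfolding p_def using mult_minus_distrib_mat_vec[OF Vt z Vg] by simp
    qed
    moreover have "?Ut *\<^sub>v (W *\<^sub>v p) = ?Ut *\<^sub>v (W *\<^sub>v z) - ?Ut *\<^sub>v (W *\<^sub>v (V *\<^sub>v g))"
      unfolding Wp_eq by (rule mult_minus_distrib_mat_vec[OF Ut Wz WVg])
    moreover have "?Vt *\<^sub>v z - g = ?Ut *\<^sub>v (W *\<^sub>v z) - ?Ut *\<^sub>v (W *\<^sub>v (V *\<^sub>v g))"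
    proof -
      define a1 a2 a3 where "a1 = ?Vt *\<^sub>v z" and "a2 = ?Ut *\<^sub>v (W *\<^sub>v z)"
        and "a3 = ?Ut *\<^sub>v (W *\<^sub>v (V *\<^sub>v g))"
      have a: "a1 \<in> carrier_vec k" "a2 \<in> carrier_vec k" "a3 \<in> carrier_vec k"
        using Vt Ut Wz WVg z by (auto simp: a1_def a2_def a3_def)
      have "(g - a3) $ i = (a1 - a2) $ i" for i using Ng by (simp add: a1_def a2_def a3_def)
      then have "g $ i - a3 $ i = a1 $ i - a2 $ i" if "i < k" for i
        using a g that by (metis carrier_vecD index_minus_vec(1))
      then have "a1 - g = a2 - a3" using a g by (intro eq_vecI) (auto simp: algebra_simps)
      then show ?thesis by (simp add: a1_def a2_def a3_def)
    qed
    ultimately have feedback: "?Ut *\<^sub>v (W *\<^sub>v p) = ?Vt *\<^sub>v p" by simp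
    \<comment> \<open>By the feedback identity the cross terms of |W p + U g|^2 and |p + V g|^2
      agree, and U, V preserve |g|. Only |W p| against |p| remains.\<close>
    have cross: "(W *\<^sub>v p) \<bullet> (U *\<^sub>v g) = p \<bullet> (V *\<^sub>v g)"
      using transpose_vec_mult_scalar[OF U(1) g Wp] transpose_vec_mult_scalar[OF V(1) g p]
      by (simp only: feedback)
    have zp: "z = p + V *\<^sub>v g"
      unfolding p_def using z V by (intro eq_vecI) auto
    have expand: "(x + y) \<bullet> (x + y) = x \<bullet> x + 2 * (x \<bullet> y) + y \<bullet> y"
      if "x \<in> carrier_vec n" "y \<in> carrier_vec n" for x y :: "real vec" and n
      using that comm_scalar_prod[OF that]
      by (simp add: add_scalar_prod_distrib[of _ n] scalar_prod_add_distrib[of _ n])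
    have "(L *\<^sub>v z) \<bullet> (L *\<^sub>v z) = (W *\<^sub>v p) \<bullet> (W *\<^sub>v p) + 2 * (p \<bullet> (V *\<^sub>v g)) + g \<bullet> g"
      unfolding Lz expand[OF Wp Ug] cross isoU[OF g] ..
    also have "\<dots> \<le> p \<bullet> p + 2 * (p \<bullet> (V *\<^sub>v g)) + g \<bullet> g" using W1[OF p] by simp
    also have "\<dots> = (p + V *\<^sub>v g) \<bullet> (p + V *\<^sub>v g)"
      unfolding expand[OF p Vg] isoV[OF g] ..
    finally show ?thesis using zp by simp
  qed
  then have "contraction n1 n2 L" using L by (simp add: contraction_def)
  then show thesis using LV C G diff that by blast
qed

subsection \<open>Perturbation of the nuclear norm\<close>

lemma sum_sing_val_mono:
  assumes "X \<in> carrier_mat n1 n2" "k \<le> r"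
  shows "(\<Sum>i = 1..k. sing_val i X) \<le> (\<Sum>i = 1..r. sing_val i X)"
  using assms by (intro sum_mono2) (auto intro: sing_val_nonneg)

text \<open>Here r may exceed min(n1, n2): the additional terms of the first sum vanish and the
  second sum is empty.\<close>

lemma nuclear_norm_split:
  assumes X: "X \<in> carrier_mat n1 n2"
  shows "nuclear_norm X
    = (\<Sum>i = 1..r. sing_val i X) + (\<Sum>i = r + 1..min n1 n2. sing_val i X)"
proof -
  have "nuclear_norm X = (\<Sum>i \<in> {1..r} \<union> {r + 1..min n1 n2}. sing_val i X)"
    unfolding nuclear_norm_def using X
    by (intro sum.mono_neutral_left)
      (auto simp: not_le sing_val_gt_dim_row[OF X] sing_val_gt_dim_col[OF X])
  also have "\<dots> = (\<Sum>i = 1..r. sing_val i X) + (\<Sum>i = r + 1..min n1 n2. sing_val i X)"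
    by (rule sum.union_disjoint) auto
  finally show ?thesis .
qed

text \<open>The polar factor attains the duality bound. As 1 / 0 = 0, directions killed by H are
  mapped to 0.\<close>

lemma polar_contraction:
  assumes H: "H \<in> carrier_mat n1 n2"
  obtains W where "contraction n1 n2 W" "mat_inner W H = nuclear_norm H"
proof -
  let ?s = "\<lambda>i. sing_val (Suc i) H"
  obtain V where V: "right_singular_system n1 n2 H V ?s"
    using ex_right_singular_system[OF H] by blast
  note D = right_singular_systemD[OF V]
  define W where "W = rescale n2 H V (\<lambda>i. 1 / ?s i)"
  have W: "contraction n1 n2 W"
    unfolding W_def
    by (rule right_singular_system_contraction[OF right_singular_system_rescale[OF V]])
      (use D(5) in auto)
  have "mat_inner W H = mat_inner H W"
    by (rule mat_inner_commute[OF contractionD(1)[OF W] H])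
  also have "\<dots> = (\<Sum>i<n2. 1 / ?s i * (?s i)\<^sup>2)"
    unfolding W_def mat_inner_rescale_right[OF V H]
    by (rule sum.cong) (auto simp: right_singular_system_cols[OF V])
  also have "\<dots> = nuclear_norm H"
    unfolding nuclear_norm_eq_sum[OF H] by (rule sum.cong) (auto simp: power2_eq_square)
  finally show thesis using W that by blast
qed

text \<open>U and V hold the singular vectors of the positive singular values. X kills the remaining
  basis vectors, so a matrix with L V = U attains the nuclear norm of X whatever it does
  there.\<close>

lemma thin_singular_system:
  assumes X: "X \<in> carrier_mat n1 n2" and r: "\<And>i. r < i \<Longrightarrow> sing_val i X = 0"
  obtains k U V where "k \<le> r" "U \<in> carrier_mat n1 k" "transpose_mat U * U = 1\<^sub>m k"
    "V \<in> carrier_mat n2 k" "transpose_mat V * V = 1\<^sub>m k"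
    "\<And>L. L \<in> carrier_mat n1 n2 \<Longrightarrow> L * V = U \<Longrightarrow> mat_inner L X = nuclear_norm X"
proof -
  let ?s = "\<lambda>i. sing_val (Suc i) X"
  obtain B where B: "right_singular_system n1 n2 X B ?s"
    using ex_right_singular_system[OF X] by blast
  note D = right_singular_systemD[OF B]
  \<comment> \<open>The values decrease, so the first zero counts the positive ones; indices r and
    n2 are zeros, which bounds k by both.\<close>
  define k where "k = (LEAST j. ?s j = 0)"
  have "?s r = 0" "?s n2 = 0" using r sing_val_gt_dim_col[OF X] by auto
  then have k: "k \<le> r" "k \<le> n2" "?s k = 0"
    unfolding k_def by (auto intro: Least_le LeastI)
  have pos: "0 < ?s i" if "i < k" for i
    using not_less_Least[of i "\<lambda>j. ?s j = 0"] that sing_val_nonneg[OF X, of "Suc i"]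
    by (simp add: k_def)
  have zero: "?s i = 0" if "k \<le> i" for i
    using sing_val_antimono[OF X, of "Suc k" "Suc i"] that k(3) sing_val_nonneg[OF X, of "Suc i"]
    by simp
  define V where "V = mat n2 k (\<lambda>(i, j). B $$ (i, j))"
  define U where "U = mat n1 k (\<lambda>(i, j). (X * B) $$ (i, j) / ?s j)"
  have V: "V \<in> carrier_mat n2 k" and U: "U \<in> carrier_mat n1 k" by (auto simp: V_def U_def)
  have colV: "col V j = col B j" if "j < k" for j
    by (rule eq_vecI) (use that k(2) D(2) in \<open>auto simp: V_def\<close>)
  have colU: "col U j = (1 / ?s j) \<cdot>\<^sub>v (X *\<^sub>v col B j)" if "j < k" for j
    by (rule eq_vecI) (use that k(2) D(1,2) in \<open>auto simp: U_def\<close>)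
  have VV: "transpose_mat V * V = 1\<^sub>m k"
    by (rule eq_matI) (use V k(2) in \<open>auto simp: colV orthogonal_cols[OF D(2,3)]\<close>)
  have Xc: "X *\<^sub>v col B j \<in> carrier_vec n1" if "j < k" for j
    by (rule mult_mat_vec_carrier[OF D(1)]) (use that D(2) k(2) in auto)
  have UU: "transpose_mat U * U = 1\<^sub>m k"
  proof (rule eq_matI)
    fix i j assume "i < dim_row (1\<^sub>m k :: real mat)" "j < dim_col (1\<^sub>m k :: real mat)"
    then have ij: "i < k" "j < k" by auto
    have "(transpose_mat U * U) $$ (i, j) = 1 / ?s i * (1 / ?s j) * ((X *\<^sub>v col B i) \<bullet> (X *\<^sub>v col B j))"
      using U ij colU Xc
      by (simp add: smult_scalar_prod_distrib[of _ n1] scalar_prod_smult_distrib[of _ n1])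
    then show "(transpose_mat U * U) $$ (i, j) = 1\<^sub>m k $$ (i, j)"
      using ij k(2) pos[of i] pos[of j] right_singular_system_cols[OF B, of i j]
      by (simp add: power2_eq_square)
  qed (use U in auto)
  have "mat_inner L X = nuclear_norm X" if L: "L \<in> carrier_mat n1 n2" and LV: "L * V = U" for L
  proof -
    have "(L *\<^sub>v col B i) \<bullet> (X *\<^sub>v col B i) = ?s i" if i: "i < n2" for i
    proof (cases "i < k")
      case True
      have "L *\<^sub>v col B i = col (L * V) i" using True L V colV by simp
      then have "(L *\<^sub>v col B i) \<bullet> (X *\<^sub>v col B i)
          = 1 / ?s i * ((X *\<^sub>v col B i) \<bullet> (X *\<^sub>v col B i))"
        unfolding LV using colU[OF True] Xc[OF True] by (simp add: smult_scalar_prod_distrib[of _ n1])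
      then show ?thesis
        using pos[OF True] right_singular_system_cols[OF B i i] by (simp add: power2_eq_square)
    next
      case False
      have Xi: "X *\<^sub>v col B i \<in> carrier_vec n1" and Li: "L *\<^sub>v col B i \<in> carrier_vec n1"
        using i D(1,2) L by auto
      have "(X *\<^sub>v col B i) \<bullet> (X *\<^sub>v col B i) = 0"
        using right_singular_system_cols[OF B i i] zero[of i] False by simp
      then have "X *\<^sub>v col B i = 0\<^sub>v n1" using conjugate_square_eq_0_vec[OF Xi] by simp
      then show ?thesis using Li zero[of i] False by simp
    qed
    then show ?thesis
      unfolding mat_inner_orthonormal_basis[OF L X D(2,4)] nuclear_norm_eq_sum[OF X]
      by (intro sum.cong) auto
  qed
  then show thesis using that[OF k(1) U UU V VV] by blast
qed

lemma nuclear_norm_perturbation: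
  assumes X: "X \<in> carrier_mat n1 n2" and H: "H \<in> carrier_mat n1 n2"
    and r: "\<And>i. r < i \<Longrightarrow> sing_val i X = 0"
  shows "nuclear_norm X + nuclear_norm H - 2 * (\<Sum>i = 1..r. sing_val i H) \<le> nuclear_norm (X + H)"
proof -
  obtain k U V where k: "k \<le> r" and U: "U \<in> carrier_mat n1 k" "transpose_mat U * U = 1\<^sub>m k"
    and V: "V \<in> carrier_mat n2 k" "transpose_mat V * V = 1\<^sub>m k"
    and LX: "\<And>L. L \<in> carrier_mat n1 n2 \<Longrightarrow> L * V = U \<Longrightarrow> mat_inner L X = nuclear_norm X"
    using thin_singular_system[OF X r] by blast
  obtain W where W: "contraction n1 n2 W" and WH: "mat_inner W H = nuclear_norm H"
    using polar_contraction[OF H] by blast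
  note WD = contractionD[OF W]
  \<comment> \<open>The scaling by t < 1 provides the strict bound needed to invert the feedback
    loop; it is removed at the end by letting t range over (0, 1).\<close>
  have "t * nuclear_norm H
      \<le> nuclear_norm (X + H) - nuclear_norm X + 2 * (\<Sum>i = 1..r. sing_val i H)"
    if t: "0 < t" "t < 1" for t
  proof -
    let ?W = "t \<cdot>\<^sub>m W"
    have tW: "?W \<in> carrier_mat n1 n2" using WD(1) by simp
    have tWz: "(?W *\<^sub>v z) \<bullet> (?W *\<^sub>v z) \<le> t\<^sup>2 * (z \<bullet> z)" if z: "z \<in> carrier_vec n2" for z
    proof -
      have "?W *\<^sub>v z = t \<cdot>\<^sub>v (W *\<^sub>v z)" by (rule eq_vecI) (use z WD(1) in auto)
      then have "(?W *\<^sub>v z) \<bullet> (?W *\<^sub>v z) = t\<^sup>2 * ((W *\<^sub>v z) \<bullet> (W *\<^sub>v z))"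
        by (simp add: power2_eq_square)
      then show ?thesis using WD(2)[OF z] by (simp add: mult_left_mono)
    qed
    have t2: "t\<^sup>2 < 1" using t by (simp add: power_less_one_iff)
    obtain L C G where L: "contraction n1 n2 L" and LV: "L * V = U"
      and C: "C \<in> carrier_mat n1 k" and G: "G \<in> carrier_mat k n2" and diff: "?W - L = C * G"
      using feedback_contraction[OF tW tWz t2 U V] by blast
    note LD = contractionD[OF L]
    \<comment> \<open>Half the difference of two contractions is a contraction, and it factors
      through dimension k, so the Ky Fan bound applies to it.\<close>
    define M where "M = (1 / 2) \<cdot>\<^sub>m (?W - L)"
    have M: "contraction n1 n2 M"
      unfolding contraction_def
    proof (intro conjI ballI)
      show "M \<in> carrier_mat n1 n2" using tW LD(1) by (simp add: M_def minus_carrier_mat)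
      fix z :: "real vec" assume z: "z \<in> carrier_vec n2"
      define x where "x = ?W *\<^sub>v z"
      define y where "y = L *\<^sub>v z"
      have x: "x \<in> carrier_vec n1" and y: "y \<in> carrier_vec n1"
        using tW LD(1) z by (auto simp: x_def y_def)
      have "M *\<^sub>v z = (1 / 2) \<cdot>\<^sub>v ((?W - L) *\<^sub>v z)"
        by (rule eq_vecI) (use z tW LD(1) in \<open>auto simp: M_def\<close>)
      also have "(?W - L) *\<^sub>v z = x - y"
        unfolding x_def y_def by (rule minus_mult_distrib_mat_vec[OF tW LD(1) z])
      finally have "(M *\<^sub>v z) \<bullet> (M *\<^sub>v z) = 1 / 4 * ((x - y) \<bullet> (x - y))" by simp
      also have "(x - y) \<bullet> (x - y) = x \<bullet> x - 2 * (x \<bullet> y) + y \<bullet> y"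
        using x y comm_scalar_prod[OF x y]
        by (simp add: minus_scalar_prod_distrib[of _ n1] scalar_prod_minus_distrib[of _ n1])
      also have "\<dots> \<le> 2 * (x \<bullet> x) + 2 * (y \<bullet> y)"
      proof -
        have "0 \<le> (x + y) \<bullet> (x + y)" by (rule scalar_prod_self_nonneg)
        also have "\<dots> = x \<bullet> x + 2 * (x \<bullet> y) + y \<bullet> y"
          using x y comm_scalar_prod[OF x y]
          by (simp add: add_scalar_prod_distrib[of _ n1] scalar_prod_add_distrib[of _ n1])
        finally show ?thesis by simp
      qed
      also have "\<dots> \<le> 2 * (z \<bullet> z) + 2 * (z \<bullet> z)"
      proof -
        have "t\<^sup>2 * (z \<bullet> z) \<le> 1 * (z \<bullet> z)"
          using t2 by (intro mult_right_mono scalar_prod_self_nonneg) simp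
        then show ?thesis using tWz[OF z] LD(2)[OF z] by (simp add: x_def y_def)
      qed
      finally show "(M *\<^sub>v z) \<bullet> (M *\<^sub>v z) \<le> z \<bullet> z" by simp
    qed
    have "M = ((1 / 2) \<cdot>\<^sub>m C) * G"
      unfolding M_def diff using C G by (simp add: mult_smult_assoc_mat)
    then have "sing_val i M = 0" if "k < i" for i
      using sing_val_mult_eq_0[of "(1 / 2) \<cdot>\<^sub>m C" n1 k G n2 i] C G that by simp
    then have "mat_inner M H \<le> (\<Sum>i = 1..k. sing_val i H)"
      by (rule ky_fan_bound[OF M _ H])
    also have "\<dots> \<le> (\<Sum>i = 1..r. sing_val i H)" by (rule sum_sing_val_mono[OF H k])
    finally have "1 / 2 * (t * nuclear_norm H - mat_inner L H) \<le> (\<Sum>i = 1..r. sing_val i H)"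
      using WH by (simp add: M_def mat_inner_smult_left mat_inner_minus_left[OF tW LD(1) H])
    moreover have "mat_inner L (X + H) \<le> nuclear_norm (X + H)"
      by (rule contraction_inner_le_nuclear_norm[OF L]) (use X H in simp)
    then have "nuclear_norm X + mat_inner L H \<le> nuclear_norm (X + H)"
      using mat_inner_add_right[OF LD(1) X H] LX[OF LD(1) LV] by simp
    ultimately show ?thesis by simp
  qed
  then have "nuclear_norm H
      \<le> nuclear_norm (X + H) - nuclear_norm X + 2 * (\<Sum>i = 1..r. sing_val i H)"
    by (rule field_le_mult_one_interval)
  then show ?thesis by simp
qed

subsection \<open>The null space condition\<close>

lemma frob_norm_right_singular_system:
  assumes V: "right_singular_system n1 n2 X V s"
  shows "(frob_norm X)\<^sup>2 = (\<Sum>i<n2. (s i)\<^sup>2)"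
proof -
  note D = right_singular_systemD[OF V]
  show ?thesis
    unfolding frob_norm_sq mat_inner_orthonormal_basis[OF D(1,1,2,4)]
    by (rule sum.cong) (auto simp: right_singular_system_cols[OF V])
qed

lemma obj_N2_right_singular_system:
  assumes "right_singular_system n1 n2 X V s"
  shows "obj_N2 \<alpha> X = (\<Sum>i<n2. s i + (s i)\<^sup>2 / (2 * \<alpha>))"
  by (simp add: obj_N2_def nuclear_norm_right_singular_system[OF assms]
      frob_norm_right_singular_system[OF assms] sum.distrib sum_divide_distrib)

text \<open>The system may be unsorted, so the largest singular value is found by comparing sets of
  values.\<close>

lemma spectral_norm_right_singular_system:
  assumes V: "right_singular_system n1 n2 X V s"
    and le: "\<And>i. i < n2 \<Longrightarrow> s i \<le> c" and j: "j < n2" "s j = c"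
  shows "spectral_norm X = c"
proof -
  note D = right_singular_systemD[OF V]
  have eq: "s ` {0..<n2} = (\<lambda>i. sing_val (Suc i) X) ` {0..<n2}"
    using mset_right_singular_system[OF V] by (metis atLeastLessThan_upt list.set_map mset_eq_setD)
  have "sing_val (Suc 0) X \<in> s ` {0..<n2}" unfolding eq using j by auto
  then have "sing_val 1 X \<le> c" using le by auto
  moreover have "c \<in> (\<lambda>i. sing_val (Suc i) X) ` {0..<n2}" unfolding eq[symmetric] using j by auto
  then have "c \<le> sing_val 1 X" using sing_val_antimono[OF D(1), of 1] by auto
  ultimately show ?thesis by (simp add: spectral_norm_def)
qed

lemma meas_index:
  assumes A: "As i \<in> carrier_mat n1 n2" and X: "X \<in> carrier_mat n1 n2" and i: "i < m"
  shows "meas m As X $ i = mat_inner (As i) X"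
proof -
  have "meas m As X $ i = (\<Sum>j<n2. \<Sum>k<n1. As i $$ (k, j) * X $$ (k, j))"
    using A X i by (simp add: meas_def mat_trace_def scalar_prod_def lessThan_atLeast0)
  also have "\<dots> = (\<Sum>k<n1. \<Sum>j<n2. As i $$ (k, j) * X $$ (k, j))" by (rule sum.swap)
  finally show ?thesis using A by (simp add: mat_inner_def)
qed

text \<open>The diagonal matrix vanishes from index r on and therefore factors through dimension
  r.\<close>

lemma rank_rescale_le:
  assumes X: "X \<in> carrier_mat n1 n2" and V: "V \<in> carrier_mat n2 n2"
    and g: "\<And>i. r \<le> i \<Longrightarrow> g i = 0"
  shows "vec_space.rank n1 (rescale n2 X V g) \<le> r"
proof -
  define E where "E = mat n2 r (\<lambda>(i, j). if i = j then g i else 0)"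
  define F where "F = mat r n2 (\<lambda>(i, j). if i = j then 1 :: real else 0)"
  have E: "E \<in> carrier_mat n2 r" and F: "F \<in> carrier_mat r n2" by (auto simp: E_def F_def)
  have EF: "mat_diag n2 g = E * F"
  proof (rule eq_matI)
    fix i j assume "i < dim_row (E * F)" "j < dim_col (E * F)"
    then have ij: "i < n2" "j < n2" using E F by auto
    have "(E * F) $$ (i, j)
        = (\<Sum>l = 0..<r. (if i = l then g i else 0) * (if l = j then 1 else 0))"
      using ij E F by (simp add: scalar_prod_def E_def F_def)
    also have "\<dots> = (\<Sum>l = 0..<r. if l = i then (if i = j then g i else 0) else 0)"
      by (rule sum.cong) auto
    also have "\<dots> = (if i = j then g i else 0)" using g[of i] by auto
    finally show "mat_diag n2 g $$ (i, j) = (E * F) $$ (i, j)"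
      using ij by (simp add: mat_diag_def)
  qed (use E F in auto)
  have "rescale n2 X V g = (X * V * E) * (F * transpose_mat V)"
    unfolding rescale_def EF using X V E F
    by (simp add: assoc_mult_mat[of _ n1 n2 _ n2 _ n2] assoc_mult_mat[of _ n1 n2 _ r _ n2]
        assoc_mult_mat[of _ n2 n2 _ n2 _ n2] assoc_mult_mat[of _ n2 r _ n2 _ n2]
        assoc_mult_mat[of _ n2 n2 _ r _ n2] assoc_mult_mat[of _ n1 n2 _ n2 _ r])
  then show ?thesis
    using rank_mult_le[of "X * V * E" n1 r "F * transpose_mat V" n2] X V E F by simp
qed

text \<open>The Ky Fan bound for -X / c, a contraction whose singular values vanish beyond
  r.\<close>

lemma mat_inner_ge_neg_spectral:
  assumes X: "X \<in> carrier_mat n1 n2" and H: "H \<in> carrier_mat n1 n2"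
    and rank: "vec_space.rank n1 X \<le> r" and c: "spectral_norm X = c" "0 < c"
  shows "- c * (\<Sum>i = 1..r. sing_val i H) \<le> mat_inner X H"
proof -
  let ?s = "\<lambda>i. sing_val (Suc i) X"
  obtain V where V: "right_singular_system n1 n2 X V ?s"
    using ex_right_singular_system[OF X] by blast
  note D = right_singular_systemD[OF V]
  define M where "M = rescale n2 X V (\<lambda>_. - 1 / c)"
  have "?s i \<le> c" for i
    using c(1) sing_val_antimono[OF X, of 1 "Suc i"] by (simp add: spectral_norm_def)
  then have M: "contraction n1 n2 M"
    unfolding M_def using c(2)
    by (intro right_singular_system_contraction[OF right_singular_system_rescale[OF V]]) auto
  obtain C G where CG: "C \<in> carrier_mat n1 (vec_space.rank n1 X)"
    "G \<in> carrier_mat (vec_space.rank n1 X) n2" "X = C * G"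
    using rank_factorization[OF X] by blast
  let ?k = "vec_space.rank n1 X"
  define B where "B = V * mat_diag n2 (\<lambda>_. - 1 / c) * transpose_mat V"
  have B: "B \<in> carrier_mat n2 n2" using D(2) by (intro carrier_matI) (auto simp: B_def)
  have "M = X * B" by (simp add: M_def rescale_def B_def)
  also have "\<dots> = C * (G * B)"
    by (subst CG(3)) (rule assoc_mult_mat[OF CG(1,2) B])
  finally have "M = C * (G * B)" .
  then have "sing_val i M = 0" if "r < i" for i
    using sing_val_mult_eq_0[of C n1 ?k "G * B" n2 i] CG(1,2) B that rank by simp
  then have "mat_inner M H \<le> (\<Sum>i = 1..r. sing_val i H)" by (rule ky_fan_bound[OF M _ H])
  also have "mat_inner M H = mat_inner H M"
    by (rule mat_inner_commute[OF contractionD(1)[OF M] H])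
  also have "\<dots> = - 1 / c * mat_inner X H"
    unfolding M_def mat_inner_rescale_right[OF V H] mat_inner_commute[OF X H]
      mat_inner_orthonormal_basis[OF H X D(2,4)] by (simp add: sum_distrib_left)
  finally show ?thesis using c(2) by (simp add: field_simps)
qed

text \<open>With S the sum of the first r singular values of H, the nuclear norm grows by at least
  (c / \<alpha>) S, which offsets the largest possible loss in the cross term of the quadratic part.
  The remaining |H|_F^2 / (2 \<alpha>) makes the inequality strict.\<close>

lemma unique_min_of_null_space_condition:
  assumes As: "\<forall>i<m. As i \<in> carrier_mat n1 n2" and \<alpha>: "0 < \<alpha>" and c: "0 < c"
    and nsp: "\<And>H. H \<in> null_space_A n1 n2 m As \<Longrightarrow>
      (1 + c / \<alpha>) * (\<Sum>i = 1..r. sing_val i H) \<le> (\<Sum>i = r + 1..min n1 n2. sing_val i H)"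
    and X: "X \<in> carrier_mat n1 n2" "vec_space.rank n1 X \<le> r" "spectral_norm X = c"
  shows "unique_min_N2 n1 n2 m As \<alpha> (meas m As X) X"
  unfolding unique_min_N2_def
proof (intro conjI ballI impI)
  fix Y assume Y: "Y \<in> carrier_mat n1 n2" and meq: "meas m As Y = meas m As X" and "Y \<noteq> X"
  define H where "H = Y - X"
  have H: "H \<in> carrier_mat n1 n2" using X Y by (auto simp: H_def)
  have YH: "Y = X + H" by (rule eq_matI) (use X Y in \<open>auto simp: H_def\<close>)
  have H0: "H \<noteq> 0\<^sub>m n1 n2"
    using YH \<open>Y \<noteq> X\<close> X by auto
  have "meas m As H = 0\<^sub>v m"
  proof (rule eq_vecI)
    fix i assume "i < dim_vec (0\<^sub>v m :: real vec)"
    then have i: "i < m" and Ai: "As i \<in> carrier_mat n1 n2" using As by auto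
    have "mat_inner (As i) Y = mat_inner (As i) X + mat_inner (As i) H"
      unfolding YH by (rule mat_inner_add_right[OF Ai X(1) H])
    then show "meas m As H $ i = 0\<^sub>v m $ i"
      using arg_cong[OF meq, of "\<lambda>v. v $ i"] i
        meas_index[of As i, OF Ai X(1) i] meas_index[of As i, OF Ai Y i]
        meas_index[of As i, OF Ai H i] by simp
  qed (simp add: meas_def)
  then have "H \<in> null_space_A n1 n2 m As" using H by (simp add: null_space_A_def)
  from nsp[OF this] have cond: "(1 + c / \<alpha>) * (\<Sum>i = 1..r. sing_val i H)
      \<le> (\<Sum>i = r + 1..min n1 n2. sing_val i H)" .
  define S where "S = (\<Sum>i = 1..r. sing_val i H)"
  have "nuclear_norm X + nuclear_norm H - 2 * S \<le> nuclear_norm Y"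
    unfolding S_def YH using X(2) sing_val_gt_rank[OF X(1)]
    by (intro nuclear_norm_perturbation[OF X(1) H]) auto
  moreover have "S + (1 + c / \<alpha>) * S \<le> nuclear_norm H"
    using cond nuclear_norm_split[OF H, of r] by (simp add: S_def)
  ultimately have nuc: "nuclear_norm X + c / \<alpha> * S \<le> nuclear_norm Y"
    by (simp add: algebra_simps)
  have "mat_inner Y Y = mat_inner X X + 2 * mat_inner X H + mat_inner H H"
    using X(1) H Y mat_inner_commute[OF Y X(1)] mat_inner_commute[OF Y H]
      mat_inner_add_right[OF Y X(1) H] mat_inner_add_right[OF X(1) X(1) H]
      mat_inner_add_right[OF H X(1) H] mat_inner_commute[OF X(1) H]
    by (simp flip: YH)
  moreover have "- c * S \<le> mat_inner X H"
    unfolding S_def by (rule mat_inner_ge_neg_spectral[OF X(1) H X(2,3) c])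
  ultimately have "mat_inner X X - 2 * c * S < mat_inner Y Y"
    using mat_inner_self_pos[OF H H0] by simp
  then have "(mat_inner X X - 2 * c * S) / (2 * \<alpha>) < mat_inner Y Y / (2 * \<alpha>)"
    using \<alpha> by (simp add: divide_strict_right_mono)
  moreover have "(mat_inner X X - 2 * c * S) / (2 * \<alpha>) = mat_inner X X / (2 * \<alpha>) - c / \<alpha> * S"
    using \<alpha> by (simp add: field_simps)
  ultimately show "obj_N2 \<alpha> X < obj_N2 \<alpha> Y"
    using nuc by (simp add: obj_N2_def frob_norm_sq)
qed (use X in auto)

section \<open>Necessity of the null space condition\<close>

lemma nonneg_of_nonneg_affine_near_0:
  fixes A B :: real
  assumes "\<And>t. 0 < t \<Longrightarrow> t \<le> \<delta> \<Longrightarrow> 0 \<le> A + t * B" and "0 < \<delta>"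
  shows "0 \<le> A"
proof -
  have "((\<lambda>t. A + t * B) \<longlongrightarrow> A + 0 * B) (at_right 0)"
    by (intro tendsto_intros)
  moreover have "eventually (\<lambda>t. 0 \<le> A + t * B) (at_right 0)"
    unfolding eventually_at_right_field using assms by (intro exI[of _ \<delta>]) auto
  ultimately show ?thesis using tendsto_lowerbound by fastforce
qed

lemma null_space_condition_of_unique_min:
  assumes As: "\<forall>i<m. As i \<in> carrier_mat n1 n2" and \<alpha>: "0 < \<alpha>" and c: "0 < c" and r: "1 \<le> r"
    and um: "\<And>X. X \<in> carrier_mat n1 n2 \<Longrightarrow> vec_space.rank n1 X \<le> r \<Longrightarrow> spectral_norm X = c \<Longrightarrow>
      unique_min_N2 n1 n2 m As \<alpha> (meas m As X) X"
    and null: "H \<in> null_space_A n1 n2 m As"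
  shows "(1 + c / \<alpha>) * (\<Sum>i = 1..r. sing_val i H) \<le> (\<Sum>i = r + 1..min n1 n2. sing_val i H)"
proof -
  let ?s = "\<lambda>i. sing_val (Suc i) H"
  have H: "H \<in> carrier_mat n1 n2" and mH: "meas m As H = 0\<^sub>v m"
    using null by (auto simp: null_space_A_def)
  have s0: "0 \<le> ?s i" for i by (rule sing_val_nonneg[OF H])
  have s_le: "?s i \<le> ?s 0" for i by (rule sing_val_antimono[OF H]) auto
  show ?thesis
  proof (cases "?s 0 = 0")
    case True
    have "sing_val i H = 0" if "1 \<le> i" for i
      using sing_val_antimono[OF H, of 1 i] that sing_val_nonneg[OF H, of i] True by simp
    then show ?thesis by simp
  next
    case False
    then have pos: "0 < ?s 0" using s0[of 0] by simp
    have n2: "0 < n2" using sing_val_gt_dim_col[OF H, of 1] False by (cases n2) auto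
    obtain V where V: "right_singular_system n1 n2 H V ?s"
      using ex_right_singular_system[OF H] by blast
    note D = right_singular_systemD[OF V]
    \<comment> \<open>Singular values of X become c at the indices below r where that of H is
      positive, and 0 elsewhere since c / 0 = 0. Index 0 is among the former, so the spectral norm
      is exactly c.\<close>
    define g where "g i = (if i < r then - c / ?s i else 0)" for i
    define X where "X = rescale n2 H V g"
    \<comment> \<open>This is X + t H written as a rescaling of H: it shares V with X, and its
      singular values are explicit.\<close>
    define Y where "Y t = rescale n2 H V (\<lambda>i. g i + t)" for t
    have X: "X \<in> carrier_mat n1 n2" unfolding X_def by (rule rescale_carrier[OF D(1,2)])
    have Y: "Y t \<in> carrier_mat n1 n2" for t unfolding Y_def by (rule rescale_carrier[OF D(1,2)])
    have svX: "right_singular_system n1 n2 X V (\<lambda>i. \<bar>g i\<bar> * ?s i)"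
      unfolding X_def by (rule right_singular_system_rescale[OF V])
    have svY: "right_singular_system n1 n2 (Y t) V (\<lambda>i. \<bar>g i + t\<bar> * ?s i)" for t
      unfolding Y_def by (rule right_singular_system_rescale[OF V])
    have "vec_space.rank n1 X \<le> r"
      unfolding X_def by (rule rank_rescale_le[OF D(1,2)]) (simp add: g_def)
    moreover have "spectral_norm X = c"
    proof (rule spectral_norm_right_singular_system[OF svX])
      show "\<bar>g i\<bar> * ?s i \<le> c" for i using c s0[of i] by (auto simp: g_def)
      show "\<bar>g 0\<bar> * ?s 0 = c" using pos c r by (simp add: g_def)
    qed (rule n2)
    ultimately have um': "unique_min_N2 n1 n2 m As \<alpha> (meas m As X) X" by (rule um[OF X])
    have meas: "meas m As (Y t) = meas m As X" for t
    proof (rule eq_vecI)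
      fix i assume "i < dim_vec (meas m As X)"
      then have i: "i < m" by (simp add: meas_def)
      then have Ai: "As i \<in> carrier_mat n1 n2" using As by simp
      let ?q = "\<lambda>j. (As i *\<^sub>v col V j) \<bullet> (H *\<^sub>v col V j)"
      have "0 = mat_inner (As i) H"
        using meas_index[of As i, OF Ai H i] mH i by simp
      also have "\<dots> = (\<Sum>j<n2. ?q j)" by (rule mat_inner_orthonormal_basis[OF Ai H D(2,4)])
      finally have "(\<Sum>j<n2. ?q j) = 0" by simp
      then have "mat_inner (As i) (Y t) = mat_inner (As i) X"
        unfolding X_def Y_def mat_inner_rescale_right[OF V Ai]
        by (simp add: distrib_right sum.distrib flip: sum_distrib_left)
      then show "meas m As (Y t) $ i = meas m As X $ i"
        using meas_index[of As i, OF Ai X i] meas_index[of As i, OF Ai Y i] by simp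
    qed (simp add: meas_def)
    define S where "S = (\<Sum>i = 1..r. sing_val i H)"
    have S: "S = (\<Sum>i<n2. if i < r then ?s i else 0)"
    proof -
      have "S = (\<Sum>i<r. ?s i)" by (simp only: S_def sum_sing_val_shift)
      also have "\<dots> = (\<Sum>i<max r n2. if i < r then ?s i else 0)"
        by (rule sum.mono_neutral_cong_left) auto
      also have "\<dots> = (\<Sum>i<n2. if i < r then ?s i else 0)"
        by (rule sum.mono_neutral_right) (auto simp: sing_val_gt_dim_col[OF H])
      finally show ?thesis .
    qed
    define B where "B = (\<Sum>i<n2. (?s i)\<^sup>2 / (2 * \<alpha>))"
    \<comment> \<open>The bound on t keeps c - t s_i nonnegative for all i, so the absolute values
      open with a fixed sign.\<close>
    have "0 \<le> (nuclear_norm H - (2 + c / \<alpha>) * S) + t * B" if t: "0 < t" "t \<le> c / ?s 0" for t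
    proof -
      have tc: "t * ?s i \<le> c" for i
      proof -
        have "t * ?s i \<le> t * ?s 0" using s_le t by (intro mult_left_mono) auto
        also have "\<dots> \<le> c" using t(2) pos by (simp add: field_simps)
        finally show ?thesis .
      qed
      \<comment> \<open>Where X has singular value c, it moves to c - t s_i; elsewhere 0 moves to t
        s_i. The factor t is pulled out for the division to come.\<close>
      have summand: "\<bar>g i + t\<bar> * ?s i + (\<bar>g i + t\<bar> * ?s i)\<^sup>2 / (2 * \<alpha>)
          = \<bar>g i\<bar> * ?s i + (\<bar>g i\<bar> * ?s i)\<^sup>2 / (2 * \<alpha>)
            + t * (?s i - (2 + c / \<alpha>) * (if i < r then ?s i else 0) + t * ((?s i)\<^sup>2 / (2 * \<alpha>)))"
        for i
      proof (cases "i < r \<and> ?s i \<noteq> 0")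
        case True
        then have si: "0 < ?s i" using s0[of i] by simp
        have gX: "\<bar>g i\<bar> * ?s i = c" using True c si by (simp add: g_def)
        have gY: "\<bar>g i + t\<bar> * ?s i = c - t * ?s i"
        proof -
          have "\<bar>g i + t\<bar> * ?s i = \<bar>(g i + t) * ?s i\<bar>" using si by (simp add: abs_mult)
          also have "(g i + t) * ?s i = t * ?s i - c" using True by (simp add: g_def field_simps)
          finally show ?thesis using tc[of i] by simp
        qed
        show ?thesis
          unfolding gX gY using True \<alpha> by (simp add: field_simps power2_eq_square)
      next
        case False
        then show ?thesis
          using t \<alpha> by (auto simp: g_def field_simps power2_eq_square)
      qed
      have "obj_N2 \<alpha> X \<le> obj_N2 \<alpha> (Y t)"
        using um' Y meas unfolding unique_min_N2_def by (metis order.strict_implies_order order_refl)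
      also have "obj_N2 \<alpha> (Y t) = obj_N2 \<alpha> X
          + t * ((nuclear_norm H - (2 + c / \<alpha>) * S) + t * B)"
        unfolding obj_N2_right_singular_system[OF svX] obj_N2_right_singular_system[OF svY] summand
          S B_def nuclear_norm_eq_sum[OF H]
        by (simp only: sum.distrib sum_subtractf sum_distrib_left[symmetric])
      finally show ?thesis using t(1) by (simp add: zero_le_mult_iff)
    qed
    \<comment> \<open>Letting t tend to 0 leaves the one-sided derivative, which
      \<open>nuclear_norm_split\<close> turns into the difference of the two sides.\<close>
    then have "0 \<le> nuclear_norm H - (2 + c / \<alpha>) * S"
      by (rule nonneg_of_nonneg_affine_near_0[of "c / ?s 0"]) (use c pos in auto)
    then show ?thesis
      using nuclear_norm_split[OF H, of r] by (simp add: S_def algebra_simps)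
  qed
qed

theorem mainTheorem8:
  fixes n1 n2 m r :: nat and As :: "nat \<Rightarrow> real mat" and \<alpha> c :: real
  assumes "0 < n1" and "0 < n2"
    and "\<forall>i < m. As i \<in> carrier_mat n1 n2"
    and "1 \<le> r" and "0 < \<alpha>" and "0 < c"
  shows "(\<forall>X0 \<in> carrier_mat n1 n2.
            vec_space.rank n1 X0 \<le> r \<longrightarrow> spectral_norm X0 = c \<longrightarrow>
            unique_min_N2 n1 n2 m As \<alpha> (meas m As X0) X0)
    \<longleftrightarrow>
         (\<forall>H \<in> null_space_A n1 n2 m As.
            (1 + c / \<alpha>) * (\<Sum>i = 1..r. sing_val i H)
              \<le> (\<Sum>i = r + 1..min n1 n2. sing_val i H))"
  using unique_min_of_null_space_condition[OF assms(3,5,6)]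
    null_space_condition_of_unique_min[OF assms(3,5,6,4)] by blast

end
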